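(* Let $r \in \{1,2,\ldots,\infty\}$ and let $M \subset \mathbb{R}^N$ be a compact, embedded $C^r$ submanifold of $\mathbb{R}^N$. Let $X \subset M$ be a compact set and let $\mu$ be a Borel probability measure on $X$. Fix $k \in \mathbb{N}$ (with $k \le N$). Then the following hold for almost every $V \in \mathrm{Gr}(k,N)$: (1) if $\mathcal{H}^k(X) = 0$ and $k \geq \dim M$, then for $\mu$-a.e. $x$ there exists $C = C(x,V) \in [0,\infty)$ such that $$\|x-y\| \leq C\,\|P_V x - P_V y\| \quad \text{for every } y \in X;$$ (2) if $k > \dim M$, then for $\mu$-a.e. $x$ there exist an open neighbourhood $U$ of $x$ in $M$ and an open neighbourhood $O$ of $P_V(x)$ in $V \cong \mathbb{R}^k$ such that $P_V$ is a $C^r$ diffeomorphism between $U$ and $O \cap P_V(M)$.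
   Context: $\mathbb{N} = \{1,2,\ldots\}$. $\mathrm{Gr}(k,N)$ is the Grassmannian of $k$-dimensional linear subspaces of $\mathbb{R}^N$, equipped with its $O(N)$-invariant Borel probability measure; "almost every" refers to this measure. For $V \in \mathrm{Gr}(k,N)$, $P_V : \mathbb{R}^N \to V$ is the orthogonal projection onto $V$. $\mathcal{H}^k$ is the $k$-dimensional Hausdorff measure and $\|\cdot\|$ is the Euclidean norm. Part of statement (2) is that $O \cap P_V(M)$ is an embedded $C^r$ submanifold of $V$. *)

theory Defs
  imports "HOL-Analysis.Analysis" "HOL-Probability.Probability_Measure"
begin

subsection \<open>Hausdorff measure\<close>

text \<open>Covering sets are required to be bounded because \<^term>\<open>diameter\<close> is a real number and carries
  no information on unbounded sets. The factor \<^term>\<open>unit_ball_vol\<close> is the normalisation for which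
  the measure of dimension \<open>n\<close> on an \<open>n\<close>-dimensional space is Lebesgue measure.\<close>

definition hausdorff_premeasure :: "nat \<Rightarrow> real \<Rightarrow> 'a::metric_space set \<Rightarrow> ennreal" where
  "hausdorff_premeasure k \<delta> A =
     (INF U \<in> {U :: nat \<Rightarrow> 'a set. A \<subseteq> (\<Union>i. U i) \<and> (\<forall>i. bounded (U i) \<and> diameter (U i) \<le> \<delta>)}.
        \<Sum>i. if U i = {} then 0 else ennreal (unit_ball_vol (real k) * (diameter (U i) / 2) ^ k))"

definition hausdorff_measure :: "nat \<Rightarrow> 'a::metric_space set \<Rightarrow> ennreal" where
  "hausdorff_measure k A = (SUP \<delta> \<in> {0<..}. hausdorff_premeasure k \<delta> A)"


subsection \<open>Orthogonal projections and the Grassmannian\<close>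

definition orth_proj :: "'a::euclidean_space set \<Rightarrow> 'a \<Rightarrow> 'a" where
  "orth_proj V x = (THE p. p \<in> V \<and> (\<forall>v\<in>V. orthogonal (x - p) v))"

lemma orth_proj_unique_ex:
  fixes V :: "'a::euclidean_space set"
  assumes "subspace V"
  shows "\<exists>!p. p \<in> V \<and> (\<forall>v\<in>V. orthogonal (x - p) v)"
proof -
  obtain y z where yz: "y \<in> span V" "\<And>w. w \<in> span V \<Longrightarrow> orthogonal z w" "x = y + z"
    using orthogonal_subspace_decomp_exists[of V x] by metis
  have sp: "span V = V"
    using assms by simp
  show ?thesis
  proof (rule ex1I)
    show "y \<in> V \<and> (\<forall>v\<in>V. orthogonal (x - y) v)"
      using yz sp by auto
  next
    fix p assume p: "p \<in> V \<and> (\<forall>v\<in>V. orthogonal (x - p) v)"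
    have "y - p \<in> V"
      using yz(1) sp p assms subspace_diff by blast
    then have "orthogonal (x - p) (y - p)" "orthogonal z (y - p)"
      using p yz(2) sp by auto
    then have "(y - p) \<bullet> (y - p) = 0"
      using yz(3) by (simp add: orthogonal_def algebra_simps)
    then show "p = y"
      by simp
  qed
qed

definition Grassmannian :: "nat \<Rightarrow> (real ^ 'n) set set" where
  "Grassmannian k = {V. subspace V \<and> dim V = k}"

text \<open>The usual topology, obtained by identifying a subspace with the matrix of the orthogonal
  projection onto it.\<close>

definition Grassmannian_topology :: "nat \<Rightarrow> (real ^ 'n) set topology" where
  "Grassmannian_topology k =
     pullback_topology (Grassmannian k) (\<lambda>V. matrix (orth_proj V)) euclidean"

definition Grassmannian_borel :: "nat \<Rightarrow> (real ^ 'n) set measure" where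
  "Grassmannian_borel k = sigma (Grassmannian k) {U. openin (Grassmannian_topology k) U}"

text \<open>This predicate determines the measure uniquely.\<close>

definition invariant_Grassmannian_measure :: "nat \<Rightarrow> (real ^ 'n) set measure \<Rightarrow> bool" where
  "invariant_Grassmannian_measure k \<gamma> \<longleftrightarrow>
     prob_space \<gamma> \<and> sets \<gamma> = sets (Grassmannian_borel k) \<and>
     (\<forall>Q. orthogonal_transformation Q \<longrightarrow>
        (\<forall>A \<in> sets \<gamma>. emeasure \<gamma> ((\<lambda>V. Q ` V) ` A) = emeasure \<gamma> A))"


subsection \<open>Maps of class \<open>C\<^sup>r\<close>\<close>

text \<open>The set \<open>S\<close> is meant to be open. In finite dimension, asking for continuity of all iterated
  directional derivatives of the total derivative is the same as the usual notion of being \<open>n\<close> times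
  continuously differentiable.\<close>

primrec Cn_on :: "nat \<Rightarrow> 'a::euclidean_space set \<Rightarrow> ('a \<Rightarrow> 'b::euclidean_space) \<Rightarrow> bool" where
  "Cn_on 0 S f \<longleftrightarrow> continuous_on S f"
| "Cn_on (Suc n) S f \<longleftrightarrow>
     (\<forall>x\<in>S. f differentiable (at x)) \<and> (\<forall>v. Cn_on n S (\<lambda>x. frechet_derivative f (at x) v))"

definition Cr_on_open :: "enat \<Rightarrow> 'a::euclidean_space set \<Rightarrow> ('a \<Rightarrow> 'b::euclidean_space) \<Rightarrow> bool" where
  "Cr_on_open r S f \<longleftrightarrow> (\<forall>n. enat n \<le> r \<longrightarrow> Cn_on n S f)"

text \<open>A map on an arbitrary subset of Euclidean space is \<open>C\<^sup>r\<close> if locally it extends to a \<open>C\<^sup>r\<close> map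
  on an open subset of the ambient space. On relatively open subsets of a linear subspace and on
  \<open>C\<^sup>r\<close> submanifolds this agrees with the intrinsic notions.\<close>

definition Cr_map :: "enat \<Rightarrow> 'a::euclidean_space set \<Rightarrow> ('a \<Rightarrow> 'b::euclidean_space) \<Rightarrow> bool" where
  "Cr_map r A f \<longleftrightarrow>
     (\<forall>x\<in>A. \<exists>W g. open W \<and> x \<in> W \<and> Cr_on_open r W g \<and> (\<forall>y\<in>A \<inter> W. g y = f y))"

definition Cr_diffeomorphism ::
  "enat \<Rightarrow> 'a::euclidean_space set \<Rightarrow> 'b::euclidean_space set \<Rightarrow> ('a \<Rightarrow> 'b) \<Rightarrow> bool" where
  "Cr_diffeomorphism r A B f \<longleftrightarrow>
     (\<exists>g. homeomorphism A B f g \<and> Cr_map r A f \<and> Cr_map r B g)"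


subsection \<open>Embedded submanifolds\<close>

text \<open>\<open>S\<close> is an embedded \<open>C\<^sup>r\<close> submanifold (without boundary) of dimension \<open>m\<close> of the linear space
  \<open>V\<close>: around each of its points some slice chart of \<open>V\<close> flattens \<open>S\<close> to an open piece of an
  \<open>m\<close>-dimensional linear subspace \<open>E\<close>.\<close>

definition embedded_submanifold ::
  "enat \<Rightarrow> nat \<Rightarrow> 'a::euclidean_space set \<Rightarrow> 'a set \<Rightarrow> bool" where
  "embedded_submanifold r m V S \<longleftrightarrow> S \<subseteq> V \<and>
     (\<forall>p\<in>S. \<exists>W W' \<phi> E.
        openin (top_of_set V) W \<and> p \<in> W \<and> openin (top_of_set V) W' \<and>
        Cr_diffeomorphism r W W' \<phi> \<and>
        subspace E \<and> E \<subseteq> V \<and> dim E = m \<and>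
        \<phi> ` (S \<inter> W) = E \<inter> W')"

end

theory Submission
  imports Defs
begin

text \<open>
  By Fubini both claims reduce to a single point \<open>x\<close> and almost every \<open>V\<close>. Averaging over \<open>y\<close> in the
  unit ball, the invariance of \<open>\<gamma>\<close> turns the volume of the slabs \<open>norm (orth_proj V y) \<le> r\<close> into the
  estimate \<open>\<gamma> {V. norm (orth_proj V y) \<le> r * norm y} \<le> C * r ^ k\<close>. Hence almost every projection
  separates \<open>x\<close> from the other points of an \<open>\<H>\<^sup>k\<close>-null set, and is injective on the tangent space at
  \<open>x\<close> when \<open>m \<le> k\<close>; compactness turns this into the inverse Lipschitz bound at \<open>x\<close>. For the second
  claim apply this to \<open>M\<close> itself, which is \<open>\<H>\<^sup>k\<close>-null if \<open>m < k\<close>: the inverse Lipschitz bound at \<open>x\<close>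
  forces injectivity on the tangent space and makes \<open>x\<close> the only preimage of its projection, so the
  inverse function theorem applies near \<open>x\<close>, and the rest of \<open>M\<close> projects away from the image of \<open>x\<close>.
\<close>

subsection \<open>Calculus of maps of class \<open>C\<^sup>n\<close>\<close>

text \<open>Conclusion (2) asserts the existence of charts and smooth inverses and has no evident
  measurability in the pair of \<open>V\<close> and \<open>x\<close>. Fubini is therefore applied
  only to the inverse Lipschitz bound, and (2) is deduced for each single pair that satisfies this
  bound over all of \<open>M\<close>, without discarding further planes. This is why injectivity on
  the tangent space is recovered from the bound instead of being carried along as a second almost
  sure property. In (1) the delicate case is \<open>m = k\<close>: the tangent space is then not
  null for the \<open>k\<close>-dimensional measure, and only the homogeneity of the condition
  lowers the dimension to \<open>m - 1\<close>. The exponent \<open>k\<close> of the slab estimate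
  matches the \<open>k\<close>-th powers of the radii in a cover of a null set, so a union bound
  over the cover is enough.\<close>

lemma Cn_on_subset: "Cn_on n S f \<Longrightarrow> T \<subseteq> S \<Longrightarrow> Cn_on n T f"
  by (induction n arbitrary: f) (auto intro: continuous_on_subset)

lemma frechet_derivative_transform_open:
  assumes "open S" "x \<in> S" "\<And>y. y \<in> S \<Longrightarrow> f y = g y" "f differentiable (at x)"
  shows "g differentiable (at x)" "frechet_derivative g (at x) = frechet_derivative f (at x)"
proof -
  have "(f has_derivative frechet_derivative f (at x)) (at x)"
    using assms(4) frechet_derivative_works by blast
  then have d: "(g has_derivative frechet_derivative f (at x)) (at x)"
    using assms(1-3) has_derivative_transform_within_open by blast
  show "g differentiable (at x)"
    using d by (auto simp: differentiable_def)
  show "frechet_derivative g (at x) = frechet_derivative f (at x)"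
    using frechet_derivative_at[OF d] by simp
qed

text \<open>Derivatives at points of \<open>S\<close> are taken in the ambient space; agreement on
  \<open>S\<close> determines them because \<open>S\<close> is open.\<close>

lemma Cn_on_cong:
  assumes "open S" "\<And>x. x \<in> S \<Longrightarrow> f x = g x" "Cn_on n S f"
  shows "Cn_on n S g"
  using assms(2,3)
proof (induction n arbitrary: f g)
  case 0
  then show ?case by (simp cong: continuous_on_cong)
next
  case (Suc n)
  have *: "g differentiable (at x)" "frechet_derivative g (at x) = frechet_derivative f (at x)"
    if "x \<in> S" for x
    using frechet_derivative_transform_open[OF assms(1) that Suc.prems(1)] Suc.prems(2) that by auto
  have "Cn_on n S (\<lambda>x. frechet_derivative g (at x) v)" for v
    by (rule Suc.IH[of "\<lambda>x. frechet_derivative f (at x) v"]) (use * Suc.prems(2) in auto)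
  then show ?case using * by auto
qed

text \<open>Continuity and ambient derivatives can be checked near each point. This turns the local
  extensions in \<open>Cr_map\<close> into a statement about the map itself.\<close>

lemma Cn_on_local:
  assumes "\<And>x. x \<in> S \<Longrightarrow> \<exists>W. open W \<and> x \<in> W \<and> Cn_on n W f"
  shows "Cn_on n S f"
  using assms
proof (induction n arbitrary: f)
  case 0
  have "isCont f x" if "x \<in> S" for x
    using 0[OF that] by (auto simp: continuous_on_eq_continuous_at)
  then show ?case by (simp add: continuous_at_imp_continuous_on)
next
  case (Suc n)
  have "f differentiable (at x)" if "x \<in> S" for x
    using Suc.prems[OF that] by auto
  moreover have "Cn_on n S (\<lambda>x. frechet_derivative f (at x) v)" for v
    by (rule Suc.IH) (metis Cn_on.simps(2) Suc.prems)
  ultimately show ?case by simp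
qed

lemma Cn_on_SucD: "Cn_on (Suc n) S f \<Longrightarrow> Cn_on n S f"
proof (induction n arbitrary: f)
  case 0
  then show ?case
    by (auto intro!: continuous_at_imp_continuous_on differentiable_imp_continuous_within)
next
  case (Suc n)
  then show ?case by (metis Cn_on.simps(2))
qed

text \<open>Replaces the chosen \<open>frechet_derivative\<close> by an explicit formula, so that
  each closure property below reduces to a differentiation rule and an induction hypothesis.\<close>

lemma Cn_on_SucI:
  assumes "open S" "\<And>x. x \<in> S \<Longrightarrow> (f has_derivative f' x) (at x)"
    "\<And>v. Cn_on n S (\<lambda>x. f' x v)"
  shows "Cn_on (Suc n) S f"
proof -
  have "frechet_derivative f (at x) = f' x" if "x \<in> S" for x
    using frechet_derivative_at[OF assms(2)[OF that]] by simp
  then have "Cn_on n S (\<lambda>x. frechet_derivative f (at x) v)" for v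
    by (intro Cn_on_cong[OF assms(1) _ assms(3)[of v]]) simp
  moreover have "f differentiable (at x)" if "x \<in> S" for x
    using assms(2)[OF that] by (rule differentiableI)
  ultimately show ?thesis by simp
qed

lemma Cn_on_has_derivative:
  "Cn_on (Suc n) S f \<Longrightarrow> x \<in> S \<Longrightarrow> (f has_derivative frechet_derivative f (at x)) (at x)"
  by (auto simp: frechet_derivative_works)

lemma Cn_on_const: "Cn_on n S (\<lambda>x. c)"
  by (induction n arbitrary: c) (auto simp: frechet_derivative_const)

lemma Cn_on_bounded_linear:
  assumes "open S" "bounded_linear L" "Cn_on n S f"
  shows "Cn_on n S (\<lambda>x. L (f x))"
  using assms(3)
proof (induction n arbitrary: f)
  case 0
  then show ?case using assms(2) by (auto intro: bounded_linear.continuous_on)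
next
  case (Suc n)
  show ?case
  proof (rule Cn_on_SucI[OF assms(1)])
    show "((\<lambda>x. L (f x)) has_derivative (\<lambda>v. L (frechet_derivative f (at x) v))) (at x)" if "x \<in> S" for x
      by (rule bounded_linear.has_derivative[OF assms(2) Cn_on_has_derivative[OF Suc.prems that]])
    show "Cn_on n S (\<lambda>x. L (frechet_derivative f (at x) v))" for v
      by (rule Suc.IH) (use Suc.prems in simp)
  qed
qed

lemma Cn_on_id:
  assumes "open S"
  shows "Cn_on n S (\<lambda>x. x)"
proof (cases n)
  case (Suc n')
  show ?thesis
    unfolding Suc by (rule Cn_on_SucI[OF assms has_derivative_ident Cn_on_const])
qed simp

lemma Cn_on_linear:
  fixes L :: "'a::euclidean_space \<Rightarrow> 'b::euclidean_space"
  shows "open S \<Longrightarrow> linear L \<Longrightarrow> Cn_on n S L"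
  using Cn_on_bounded_linear[OF _ _ Cn_on_id, of S L n] by (simp add: linear_conv_bounded_linear)

lemma Cn_on_add:
  assumes "open S" "Cn_on n S f" "Cn_on n S g"
  shows "Cn_on n S (\<lambda>x. f x + g x)"
  using assms(2,3)
proof (induction n arbitrary: f g)
  case 0
  then show ?case by (auto intro: continuous_on_add)
next
  case (Suc n)
  show ?case
  proof (rule Cn_on_SucI[OF assms(1)])
    show "((\<lambda>x. f x + g x) has_derivative
        (\<lambda>v. frechet_derivative f (at x) v + frechet_derivative g (at x) v)) (at x)" if "x \<in> S" for x
      by (rule has_derivative_add[OF Suc.prems[THEN Cn_on_has_derivative, OF that]])
    show "Cn_on n S (\<lambda>x. frechet_derivative f (at x) v + frechet_derivative g (at x) v)" for v
      by (rule Suc.IH) (use Suc.prems in simp_all)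
  qed
qed

lemma Cn_on_sum:
  assumes "open S" "\<And>i. i \<in> I \<Longrightarrow> Cn_on n S (f i)"
  shows "Cn_on n S (\<lambda>x. \<Sum>i\<in>I. f i x)"
  using assms(2)
  by (induction I rule: infinite_finite_induct) (auto intro: Cn_on_const Cn_on_add assms(1))

lemma Cn_on_scaleR:
  fixes f :: "'a::euclidean_space \<Rightarrow> real"
  assumes "open S" "Cn_on n S f" "Cn_on n S g"
  shows "Cn_on n S (\<lambda>x. f x *\<^sub>R g x)"
  using assms(2,3)
proof (induction n arbitrary: f g)
  case 0
  then show ?case by (auto intro: continuous_on_scaleR)
next
  case (Suc n)
  show ?case
  proof (rule Cn_on_SucI[OF assms(1), of _ "\<lambda>x v. f x *\<^sub>R frechet_derivative g (at x) v +
      frechet_derivative f (at x) v *\<^sub>R g x"])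
    show "((\<lambda>x. f x *\<^sub>R g x) has_derivative
       (\<lambda>v. f x *\<^sub>R frechet_derivative g (at x) v + frechet_derivative f (at x) v *\<^sub>R g x)) (at x)"
      if "x \<in> S" for x
      using Suc.prems that by (intro has_derivative_scaleR) (auto simp: frechet_derivative_works)
    show "Cn_on n S (\<lambda>x. f x *\<^sub>R frechet_derivative g (at x) v + frechet_derivative f (at x) v *\<^sub>R g x)" for v
      using Suc.prems Suc.prems[THEN Cn_on_SucD] by (intro Cn_on_add assms(1) Suc.IH) auto
  qed
qed

lemma Cn_on_mult:
  fixes f g :: "'a::euclidean_space \<Rightarrow> real"
  shows "open S \<Longrightarrow> Cn_on n S f \<Longrightarrow> Cn_on n S g \<Longrightarrow> Cn_on n S (\<lambda>x. f x * g x)"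
  using Cn_on_scaleR[of S n f g] by simp

lemma Cn_on_prod:
  fixes f :: "'i \<Rightarrow> 'a::euclidean_space \<Rightarrow> real"
  assumes "open S" "\<And>i. i \<in> I \<Longrightarrow> Cn_on n S (f i)"
  shows "Cn_on n S (\<lambda>x. \<Prod>i\<in>I. f i x)"
  using assms(2)
  by (induction I rule: infinite_finite_induct) (auto intro: Cn_on_const Cn_on_mult assms(1))

lemma Cn_on_diff:
  assumes "open S" "Cn_on n S f" "Cn_on n S g"
  shows "Cn_on n S (\<lambda>x. f x - g x)"
  using Cn_on_add[OF assms(1,2) Cn_on_bounded_linear[OF assms(1) bounded_linear_minus[OF bounded_linear_ident] assms(3)]]
  by simp

text \<open>The derivative of the reciprocal contains the reciprocal itself, but only to the
  previous order, so the induction runs with \<open>f\<close> fixed.\<close>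

lemma Cn_on_inverse:
  fixes f :: "'a::euclidean_space \<Rightarrow> real"
  assumes "open S" "Cn_on n S f" "\<And>x. x \<in> S \<Longrightarrow> f x \<noteq> 0"
  shows "Cn_on n S (\<lambda>x. inverse (f x))"
  using assms(2)
proof (induction n)
  case 0
  then show ?case using assms(3) by (auto intro: continuous_on_inverse)
next
  case (Suc n)
  note IH = Suc.IH[OF Cn_on_SucD[OF Suc.prems]]
  show ?case
  proof (rule Cn_on_SucI[OF assms(1), of _ "\<lambda>x v. - (inverse (f x) * frechet_derivative f (at x) v * inverse (f x))"])
    show "((\<lambda>x. inverse (f x)) has_derivative
       (\<lambda>v. - (inverse (f x) * frechet_derivative f (at x) v * inverse (f x)))) (at x)"
      if "x \<in> S" for x
      using Suc.prems that assms(3)[OF that] by (intro Deriv.has_derivative_inverse) (auto simp: frechet_derivative_works)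
    show "Cn_on n S (\<lambda>x. - (inverse (f x) * frechet_derivative f (at x) v * inverse (f x)))" for v
      using Suc.prems IH
      by (intro Cn_on_bounded_linear[OF assms(1) bounded_linear_minus[OF bounded_linear_ident]] Cn_on_mult assms(1)) auto
  qed
qed

text \<open>\<open>Cn_on\<close> speaks of derivatives in fixed directions, whereas the direction in
  the chain rule moves with \<open>x\<close>. Expanding it in the basis leaves products of scalar
  functions with derivatives of \<open>g\<close> in basis directions, to which the induction
  hypothesis applies with \<open>g\<close> replaced by such a derivative.\<close>

lemma Cn_on_compose:
  fixes f :: "'a::euclidean_space \<Rightarrow> 'b::euclidean_space"
    and g :: "'b \<Rightarrow> 'c::euclidean_space"
  assumes "open S" "open T" "f ` S \<subseteq> T" "Cn_on n S f" "Cn_on n T g"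
  shows "Cn_on n S (\<lambda>x. g (f x))"
  using assms(4,5)
proof (induction n arbitrary: g)
  case 0
  then show ?case using assms(3) by (auto intro: continuous_on_compose2)
next
  case (Suc n)
  let ?f' = "\<lambda>x. frechet_derivative f (at x)" and ?g' = "\<lambda>x. frechet_derivative g (at x)"
  have g: "(g has_derivative ?g' (f x)) (at (f x))" if "x \<in> S" for x
    using Suc.prems(2) assms(3) that by (auto simp: frechet_derivative_works)
  have eq: "?g' (f x) (?f' x v) = (\<Sum>i\<in>Basis. (?f' x v \<bullet> i) *\<^sub>R ?g' (f x) i)" if "x \<in> S" for x v
  proof -
    have "linear (?g' (f x))"
      using g[OF that] has_derivative_linear by blast
    then show ?thesis
      by (subst euclidean_representation[of "?f' x v", symmetric])
         (simp add: linear_sum linear_scale del: euclidean_representation)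
  qed
  show ?case
  proof (rule Cn_on_SucI[OF assms(1), of _ "\<lambda>x v. ?g' (f x) (?f' x v)"])
    show "((\<lambda>x. g (f x)) has_derivative (\<lambda>v. ?g' (f x) (?f' x v))) (at x)" if "x \<in> S" for x
      using has_derivative_compose[OF Cn_on_has_derivative[OF Suc.prems(1) that] g[OF that]] .
    fix v
    have "Cn_on n S (\<lambda>x. \<Sum>i\<in>Basis. (?f' x v \<bullet> i) *\<^sub>R ?g' (f x) i)"
    proof (intro Cn_on_sum Cn_on_scaleR assms(1))
      show "Cn_on n S (\<lambda>x. ?f' x v \<bullet> i)" for i
        by (rule Cn_on_bounded_linear[OF assms(1) bounded_linear_inner_left]) (use Suc.prems in auto)
      show "Cn_on n S (\<lambda>x. ?g' (f x) i)" for i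
        by (rule Suc.IH) (use Suc.prems Cn_on_SucD in auto)
    qed
    then show "Cn_on n S (\<lambda>x. ?g' (f x) (?f' x v))"
      by (rule Cn_on_cong[OF assms(1), rotated]) (use eq in auto)
  qed
qed

lemma Cn_on_vec_lambda:
  fixes f :: "'a::euclidean_space \<Rightarrow> 'n::finite \<Rightarrow> real"
  assumes "open S" "\<And>i. Cn_on n S (\<lambda>x. f x i)"
  shows "Cn_on n S (\<lambda>x. \<chi> i. f x i)"
proof -
  have "(\<lambda>x. \<chi> i. f x i) = (\<lambda>x. \<Sum>i\<in>UNIV. f x i *\<^sub>R axis i (1::real))"
    by (simp add: fun_eq_iff vec_eq_iff axis_def if_distrib cong: if_cong)
  then show ?thesis
    using assms by (auto intro!: Cn_on_sum Cn_on_scaleR Cn_on_const)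
qed

lemma Cn_on_det:
  fixes A :: "'a::euclidean_space \<Rightarrow> real^'n^'n"
  assumes "open S" "\<And>i j. Cn_on n S (\<lambda>x. A x $ i $ j)"
  shows "Cn_on n S (\<lambda>x. det (A x))"
  unfolding det_def by (intro Cn_on_sum Cn_on_mult Cn_on_prod Cn_on_const assms)

text \<open>The derivative of the inverse is expressed through that of \<open>h\<close> and the inverse itself by Cramer's
  rule, so each order of smoothness of the inverse yields the next one.\<close>

lemma Cn_on_inverse_function:
  fixes h g :: "real^'n \<Rightarrow> real^'n"
  assumes "open U" "open V" "g ` V \<subseteq> U" "continuous_on V g"
    and der: "\<And>y. y \<in> V \<Longrightarrow> (g has_derivative inv (frechet_derivative h (at (g y)))) (at y)"
    and bij: "\<And>y. y \<in> V \<Longrightarrow> bij (frechet_derivative h (at (g y)))"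
    and "Cn_on n U h"
  shows "Cn_on n V g"
  using assms(7)
proof (induction n)
  case 0
  then show ?case using assms by simp
next
  case (Suc n)
  let ?h' = "\<lambda>x. frechet_derivative h (at x)"
  let ?A = "\<lambda>y. matrix (?h' (g y))"
  have IH: "Cn_on n V g"
    using Suc Cn_on_SucD by blast
  have A: "?A y *v v = ?h' (g y) v" "det (?A y) \<noteq> 0" if "y \<in> V" for y v
  proof -
    have l: "linear (?h' (g y))"
      using Cn_on_has_derivative[OF Suc.prems] assms(3) that has_derivative_linear by blast
    show "?A y *v v = ?h' (g y) v"
      using l by simp
    show "det (?A y) \<noteq> 0"
      using bij[OF that] by (simp add: bij_def det_nz_iff_inj[OF l])
  qed
  have entry: "Cn_on n V (\<lambda>y. ?A y $ i $ j)" for i j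
  proof -
    have "Cn_on n V (\<lambda>y. ?h' (g y) (axis j 1))"
      using Suc.prems by (intro Cn_on_compose[OF assms(2,1,3) IH]) auto
    from Cn_on_bounded_linear[OF assms(2) bounded_linear_vec_nth this, of i]
    show ?thesis by (simp add: matrix_def)
  qed
  show ?case
  proof (rule Cn_on_SucI[OF assms(2) der])
    fix v
    let ?c = "\<lambda>y. \<chi> k. det (\<chi> i j. if j = k then v $ i else ?A y $ i $ j) / det (?A y)"
    have "Cn_on n V (\<lambda>y. det (\<chi> i j. if j = k then v $ i else ?A y $ i $ j))" for k
    proof (rule Cn_on_det[OF assms(2)])
      show "Cn_on n V (\<lambda>y. (\<chi> i j. if j = k then v $ i else ?A y $ i $ j) $ i $ j)" for i j
        by (cases "j = k") (simp_all add: Cn_on_const entry)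
    qed
    moreover have "Cn_on n V (\<lambda>y. inverse (det (?A y)))"
      by (rule Cn_on_inverse[OF assms(2) Cn_on_det[OF assms(2) entry] A(2)])
    ultimately have c: "Cn_on n V ?c"
      unfolding divide_inverse by (intro Cn_on_vec_lambda Cn_on_mult assms(2))
    have eq: "?c y = inv (?h' (g y)) v" if "y \<in> V" for y
    proof -
      have "?A y *v inv (?h' (g y)) v = v"
        using A(1)[OF that] bij[OF that] by (simp add: bij_def surj_f_inv_f)
      from iffD1[OF cramer[OF A(2)[OF that]] this] show ?thesis by (rule sym)
    qed
    show "Cn_on n V (\<lambda>y. inv (?h' (g y)) v)"
      by (rule Cn_on_cong[OF assms(2) eq c])
  qed auto
qed

text \<open>The map inverted later is built to have identity derivative at the base point, so the
  identity serves as inverse of the derivative there. The local inverse obtained from the once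
  differentiable case is raised to class \<open>r\<close> by
  \<open>Cn_on_inverse_function\<close>.\<close>

lemma Cr_inverse_function:
  fixes h :: "real^'n \<Rightarrow> real^'n"
  assumes "1 \<le> r" "open U" "x0 \<in> U" "Cr_on_open r U h"
    and "(h has_derivative (\<lambda>v. v)) (at x0)"
  obtains U' V g where "open U'" "U' \<subseteq> U" "x0 \<in> U'" "open V" "homeomorphism U' V h g"
    "Cr_on_open r V g"
proof -
  have "Cn_on 1 U h"
    using assms(1,4) unfolding Cr_on_open_def by (metis one_enat_def)
  then have C1: "Cn_on (Suc 0) U h" by simp
  let ?h' = "\<lambda>x. frechet_derivative h (at x)"
  have bl: "bounded_linear (?h' x)" if "x \<in> U" for x
    using Cn_on_has_derivative[OF C1 that] has_derivative_bounded_linear by blast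
  have ap: "blinfun_apply (Blinfun (?h' x)) = ?h' x" if "x \<in> U" for x
    using bounded_linear_Blinfun_apply[OF bl[OF that]] .
  \<comment> \<open>In finite dimension, continuity of every directional derivative is continuity of
    the derivative in operator norm.\<close>
  have "continuous_on U (\<lambda>x. Blinfun (?h' x))"
  proof (rule continuous_on_blinfun_componentwise)
    fix i :: "real^'n"
    have "continuous_on U (\<lambda>x. ?h' x i)" using C1 by simp
    then show "continuous_on U (\<lambda>x. blinfun_apply (Blinfun (?h' x)) i)"
      by (rule continuous_on_eq) (simp add: ap)
  qed
  moreover have "id_blinfun o\<^sub>L Blinfun (?h' x0) = id_blinfun"
  proof -
    have "?h' x0 = (\<lambda>v. v)" using frechet_derivative_at[OF assms(5)] by simp
    then show ?thesis using ap[OF assms(3)] by (intro blinfun_eqI) simp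
  qed
  moreover have "(h has_derivative blinfun_apply (Blinfun (?h' x))) (at x)" if "x \<in> U" for x
    using Cn_on_has_derivative[OF C1 that] ap[OF that] by simp
  ultimately obtain U' V g g' where *: "open U'" "U' \<subseteq> U" "x0 \<in> U'" "open V" "homeomorphism U' V h g"
    "\<And>y. y \<in> V \<Longrightarrow> (g has_derivative (g' y)) (at y)"
    "\<And>y. y \<in> V \<Longrightarrow> g' y = inv (blinfun_apply (Blinfun (?h' (g y))))"
    "\<And>y. y \<in> V \<Longrightarrow> bij (blinfun_apply (Blinfun (?h' (g y))))"
    using inverse_function_theorem[OF assms(2) _ _ assms(3), of h "\<lambda>x. Blinfun (?h' x)" id_blinfun] by metis
  have gU: "g ` V \<subseteq> U" using *(2,5) by (auto simp: homeomorphism_def)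
  have "Cn_on n V g" if "enat n \<le> r" for n
  proof (rule Cn_on_inverse_function[OF assms(2) *(4) gU])
    show "continuous_on V g" using *(5) by (simp add: homeomorphism_def)
    show "(g has_derivative inv (?h' (g y))) (at y)" if "y \<in> V" for y
      using *(6,7)[OF that] ap gU that by force
    show "bij (?h' (g y))" if "y \<in> V" for y
      using *(8)[OF that] ap gU that by force
    show "Cn_on n U h"
      using assms(4) that by (simp add: Cr_on_open_def)
  qed
  then show ?thesis
    using * that by (auto simp: Cr_on_open_def)
qed

subsection \<open>Orthogonal projections\<close>

lemma
  fixes V :: "'a::euclidean_space set"
  assumes "subspace V"
  shows orth_proj_in: "orth_proj V x \<in> V"
    and orth_proj_orthogonal: "v \<in> V \<Longrightarrow> orthogonal (x - orth_proj V x) v"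
  using theI'[OF orth_proj_unique_ex[OF assms, of x]] by (auto simp: orth_proj_def)

lemma orth_projI:
  fixes V :: "'a::euclidean_space set"
  assumes "subspace V" "p \<in> V" "\<And>v. v \<in> V \<Longrightarrow> orthogonal (x - p) v"
  shows "orth_proj V x = p"
  unfolding orth_proj_def
  by (rule the1_equality[OF orth_proj_unique_ex[OF assms(1)]]) (use assms in auto)

lemma orth_proj_id: "subspace V \<Longrightarrow> x \<in> V \<Longrightarrow> orth_proj V x = x"
  by (rule orth_projI) (auto simp: orthogonal_def)

lemma linear_orth_proj:
  fixes V :: "'a::euclidean_space set"
  assumes "subspace V"
  shows "linear (orth_proj V)"
proof (rule linearI)
  note * = orth_proj_in[OF assms] orth_proj_orthogonal[OF assms]
  show "orth_proj V (x + y) = orth_proj V x + orth_proj V y" for x y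
  proof (rule orth_projI[OF assms])
    show "orth_proj V x + orth_proj V y \<in> V"
      by (rule subspace_add[OF assms *(1) *(1)])
    show "orthogonal (x + y - (orth_proj V x + orth_proj V y)) v" if "v \<in> V" for v
      using *(2)[OF that, of x] *(2)[OF that, of y] by (simp add: orthogonal_def inner_diff_left inner_add_left)
  qed
  show "orth_proj V (c *\<^sub>R x) = c *\<^sub>R orth_proj V x" for c x
  proof (rule orth_projI[OF assms])
    show "c *\<^sub>R orth_proj V x \<in> V"
      by (rule subspace_scale[OF assms *(1)])
    show "orthogonal (c *\<^sub>R x - c *\<^sub>R orth_proj V x) v" if "v \<in> V" for v
      using *(2)[OF that, of x] by (simp add: orthogonal_def inner_diff_left)
  qed
qed

lemma norm_orth_proj_Pythagoras:
  fixes V :: "'a::euclidean_space set"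
  assumes "subspace V"
  shows "(norm x)\<^sup>2 = (norm (orth_proj V x))\<^sup>2 + (norm (x - orth_proj V x))\<^sup>2"
proof -
  have "orthogonal (orth_proj V x) (x - orth_proj V x)"
    using orth_proj_orthogonal[OF assms orth_proj_in[OF assms]] orthogonal_commute by blast
  from norm_add_Pythagorean[OF this] show ?thesis by simp
qed

lemma norm_orth_proj_le:
  fixes V :: "'a::euclidean_space set"
  assumes "subspace V"
  shows "norm (orth_proj V x) \<le> norm x"
    and "norm (x - orth_proj V x) \<le> norm x"
  by (rule power2_le_imp_le, simp add: norm_orth_proj_Pythagoras[OF assms, of x], simp)+

text \<open>This equivariance is what makes the invariance of \<open>\<gamma>\<close> usable:
  rotating plane and vector together changes no norm of a projection.\<close>

lemma orth_proj_orthogonal_image: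
  assumes "subspace V" "orthogonal_transformation Q"
  shows "orth_proj (Q ` V) (Q x) = Q (orth_proj V x)"
proof (rule orth_projI)
  have l: "linear Q" using assms(2) by (rule orthogonal_transformation_linear)
  show "subspace (Q ` V)" using l assms(1) by (rule linear_subspace_image)
  show "Q (orth_proj V x) \<in> Q ` V" using orth_proj_in[OF assms(1)] by simp
  show "orthogonal (Q x - Q (orth_proj V x)) v" if "v \<in> Q ` V" for v
    using that orth_proj_orthogonal[OF assms(1)] assms(2)
    by (auto simp: linear_diff[OF l, symmetric] orthogonal_orthogonal_transformation)
qed

section \<open>Grid covers and the volume of slabs\<close>

text \<open>Round every coefficient down to a multiple of \<open>1 / n\<close>: there are
  \<open>2 * n + 1\<close> values for each, and each rounding costs at most \<open>1 / n\<close>.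
  The triangle inequality adds these errors, whence the factor \<open>card B\<close>.\<close>

lemma cube_cover:
  fixes B :: "'a::real_normed_vector set"
  assumes "finite B" "\<And>b. b \<in> B \<Longrightarrow> norm b \<le> 1" "n \<ge> 1"
  shows "\<exists>F. finite F \<and> card F \<le> (2 * n + 1) ^ card B \<and>
    (\<forall>c. (\<forall>b\<in>B. \<bar>c b\<bar> \<le> 1) \<longrightarrow> (\<exists>y\<in>F. norm ((\<Sum>b\<in>B. c b *\<^sub>R b) - y) \<le> real (card B) / real n))"
  using assms(1,2)
proof (induction B rule: finite_induct)
  case empty
  show ?case by (rule exI[of _ "{0}"]) simp
next
  case (insert b B)
  then obtain F where F: "finite F" "card F \<le> (2 * n + 1) ^ card B"
    "\<And>c. (\<forall>b\<in>B. \<bar>c b\<bar> \<le> 1) \<Longrightarrow> (\<exists>y\<in>F. norm ((\<Sum>b\<in>B. c b *\<^sub>R b) - y) \<le> real (card B) / real n)"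
    by auto
  let ?I = "{- int n..int n}"
  let ?F = "(\<lambda>(y, j). y + (real_of_int j / real n) *\<^sub>R b) ` (F \<times> ?I)"
  show ?case
  proof (intro exI[of _ ?F] conjI allI impI)
    show "finite ?F" using F(1) by simp
    have "card ?F \<le> card F * card ?I"
      using card_image_le[of "F \<times> ?I"] F(1) by (simp add: card_cartesian_product)
    also have "card ?I = 2 * n + 1" by simp
    also have "card F * (2 * n + 1) \<le> (2 * n + 1) ^ card B * (2 * n + 1)"
      using F(2) by (rule mult_right_mono) simp
    finally show "card ?F \<le> (2 * n + 1) ^ card (insert b B)"
      using insert by (simp add: mult.commute)
  next
    fix c assume c: "\<forall>b\<in>insert b B. \<bar>c b\<bar> \<le> (1::real)"
    then obtain y where y: "y \<in> F" "norm ((\<Sum>b\<in>B. c b *\<^sub>R b) - y) \<le> real (card B) / real n"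
      using F(3)[of c] by auto
    define j where "j = \<lfloor>c b * real n\<rfloor>"
    have cb: "- real n \<le> c b * real n" "c b * real n \<le> real n"
      using c assms(3) mult_right_mono[of "c b" 1 "real n"] mult_right_mono[of "-1" "c b" "real n"]
      by (auto simp: abs_le_iff)
    then have j: "j \<in> ?I"
      unfolding j_def by (auto simp: le_floor_iff floor_le_iff)
    have "\<bar>c b * real n - j\<bar> \<le> 1" unfolding j_def by linarith
    moreover have "c b - j / real n = (c b * real n - j) / real n"
      using assms(3) by (simp add: field_simps)
    ultimately have "\<bar>c b - j / real n\<bar> \<le> 1 / real n"
      using assms(3) by (simp add: divide_right_mono)
    then have "\<bar>c b - j / real n\<bar> * norm b \<le> 1 / real n * 1"
      using insert.prems by (intro mult_mono) auto
    then have "norm ((c b - j / real n) *\<^sub>R b) \<le> 1 / real n" by simp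
    then have "norm (((\<Sum>b\<in>B. c b *\<^sub>R b) - y) + (c b - j / real n) *\<^sub>R b) \<le> real (card B) / real n + 1 / real n"
      using y(2) by (intro norm_triangle_le add_mono)
    moreover have "((\<Sum>b\<in>B. c b *\<^sub>R b) - y) + (c b - j / real n) *\<^sub>R b =
        (\<Sum>b\<in>insert b B. c b *\<^sub>R b) - (y + (j / real n) *\<^sub>R b)"
      using insert by (simp add: algebra_simps)
    moreover have "real (card B) / real n + 1 / real n = real (card (insert b B)) / real n"
      using insert by (simp add: add_divide_distrib)
    ultimately have "norm ((\<Sum>b\<in>insert b B. c b *\<^sub>R b) - (y + (j / real n) *\<^sub>R b)) \<le> real (card (insert b B)) / real n"
      by simp
    moreover have "y + (j / real n) *\<^sub>R b \<in> ?F"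
      using y(1) j by force
    ultimately show "\<exists>y\<in>?F. norm ((\<Sum>b\<in>insert b B. c b *\<^sub>R b) - y) \<le> real (card (insert b B)) / real n"
      by blast
  qed
qed

text \<open>The unit ball of the orthogonal complement of \<open>V\<close> is covered by about \<open>(1 / r) ^ (N - k)\<close> balls
  of radius \<open>r\<close>, hence the slab by as many balls of volume of order \<open>r ^ N\<close>.\<close>

lemma slab_volume:
  fixes k :: nat
  assumes "k \<le> CARD('n)"
  obtains C :: real where "C > 0"
    "\<And>V r. subspace V \<Longrightarrow> dim V = k \<Longrightarrow> 0 < r \<Longrightarrow> r \<le> 1 \<Longrightarrow>
      emeasure lborel {y :: real^'n. norm y \<le> 1 \<and> norm (orth_proj V y) \<le> r} \<le> ennreal (C * r ^ k)"
proof -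
  define N where "N = CARD('n)"
  define d where "d = N - k"
  \<comment> \<open>\<open>6 ^ d\<close> comes from \<open>2 * n + 1 \<le> 6 / r\<close>, and
    \<open>d + 1\<close> from the radius of the covering balls. The powers of \<open>r\<close>
    combine as \<open>(1 / r) ^ d * r ^ N = r ^ k\<close>.\<close>
  define C where "C = 6 ^ d * (unit_ball_vol (real N) * (real d + 1) ^ N)"
  have "C > 0" unfolding C_def by simp
  moreover have "emeasure lborel {y :: real^'n. norm y \<le> 1 \<and> norm (orth_proj V y) \<le> r} \<le> ennreal (C * r ^ k)"
    if V: "subspace V" "dim V = k" and r: "0 < r" "r \<le> 1" for V :: "(real^'n) set" and r
  proof -
    define W where "W = {y \<in> UNIV. \<forall>x\<in>V. orthogonal x y}"
    have W: "dim W = d"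
      using dim_subspace_orthogonal_to_vectors[of V UNIV] V unfolding W_def d_def N_def by simp
    have "subspace W"
      unfolding W_def using subspace_orthogonal_to_vectors by auto
    then obtain B where B: "B \<subseteq> W" "pairwise orthogonal B" "\<And>b. b \<in> B \<Longrightarrow> norm b = 1"
      "independent B" "card B = dim W" "span B = W"
      using orthonormal_basis_subspace by blast
    have finB: "finite B" using B(4) independent_imp_finite by blast
    define n where "n = nat \<lceil>1 / r\<rceil>"
    have r1: "1 / r \<ge> 1" using r by simp
    have n: "1 / r \<le> real n" "real n \<le> 1 / r + 1"
      using r1 unfolding n_def by linarith+
    have n1: "n \<ge> 1" using n(1) r1 by linarith
    obtain F where F: "finite F" "card F \<le> (2 * n + 1) ^ card B"
      "\<And>c. (\<forall>b\<in>B. \<bar>c b\<bar> \<le> 1) \<Longrightarrow> (\<exists>y\<in>F. norm ((\<Sum>b\<in>B. c b *\<^sub>R b) - y) \<le> real (card B) / real n)"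
      using cube_cover[OF finB, of n] B(3) n1 by force
    let ?S = "{y :: real^'n. norm y \<le> 1 \<and> norm (orth_proj V y) \<le> r}"
    let ?R = "(real d + 1) * r"
    \<comment> \<open>The component in \<open>W\<close> is within \<open>d * r\<close> of a grid
      point, and the component in \<open>V\<close> has length at most \<open>r\<close>.\<close>
    have sub: "?S \<subseteq> (\<Union>y\<in>F. cball y ?R)"
    proof
      fix y assume y: "y \<in> ?S"
      define z where "z = y - orth_proj V y"
      have zW: "z \<in> W"
        unfolding W_def z_def using orth_proj_orthogonal[OF V(1)] by (auto simp: orthogonal_commute)
      have nz: "norm z \<le> 1"
        using norm_orth_proj_le(2)[OF V(1), of y] y unfolding z_def by auto
      have "\<bar>z \<bullet> b\<bar> \<le> 1" if "b \<in> B" for b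
        using Cauchy_Schwarz_ineq2[of z b] nz B(3)[OF that] by simp
      then obtain w where w: "w \<in> F" "norm ((\<Sum>b\<in>B. (z \<bullet> b) *\<^sub>R b) - w) \<le> real (card B) / real n"
        using F(3)[of "\<lambda>b. z \<bullet> b"] by auto
      have "(\<Sum>b\<in>B. (z \<bullet> b) *\<^sub>R b) = z"
        by (rule orthonormal_basis_expand[OF B(2,3) _ finB]) (use zW B(6) in auto)
      with w(2) have "norm (z - w) \<le> real d / real n" using W B(5) by simp
      also have "\<dots> \<le> real d * r"
      proof -
        have "1 / real n \<le> r" using n(1) n1 r by (simp add: field_simps)
        then show ?thesis using mult_left_mono[of "1 / real n" r "real d"] by simp
      qed
      finally have "norm (z - w) \<le> real d * r" .
      moreover have "norm (orth_proj V y) \<le> r" using y by simp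
      ultimately have "norm ((z - w) + orth_proj V y) \<le> real d * r + r"
        by (intro norm_triangle_le add_mono)
      moreover have "(z - w) + orth_proj V y = y - w" unfolding z_def by simp
      ultimately have "dist w y \<le> ?R" by (simp add: dist_norm norm_minus_commute algebra_simps)
      then show "y \<in> (\<Union>y\<in>F. cball y ?R)" using w(1) by auto
    qed
    have "emeasure lborel ?S \<le> emeasure lborel (\<Union>y\<in>F. cball y ?R)"
      by (rule emeasure_mono[OF sub]) (use F(1) in \<open>auto intro!: borel_closed closed_UN\<close>)
    also have "\<dots> \<le> (\<Sum>y\<in>F. emeasure lborel (cball y ?R))"
      by (rule emeasure_subadditive_finite[OF F(1)]) auto
    also have "\<dots> = ennreal (real (card F) * (unit_ball_vol (real N) * ?R ^ N))"
      using r unfolding N_def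
      by (simp add: emeasure_cball ennreal_of_nat_eq_real_of_nat ennreal_mult')
    also have "\<dots> \<le> ennreal ((6 / r) ^ d * (unit_ball_vol (real N) * ?R ^ N))"
    proof (intro ennreal_leI mult_right_mono)
      have "real (card F) \<le> real ((2 * n + 1) ^ d)"
        using F(2) W B(5) by (metis of_nat_le_iff)
      also have "\<dots> = (2 * real n + 1) ^ d" by (simp add: add.commute)
      also have "\<dots> \<le> (6 / r) ^ d"
      proof (rule power_mono)
        have "1 \<le> 1 / r" using r by simp
        then show "2 * real n + 1 \<le> 6 / r" using n(2) by simp
      qed simp
      finally show "real (card F) \<le> (6 / r) ^ d" .
    qed (use r in auto)
    also have "(6 / r) ^ d * (unit_ball_vol (real N) * ?R ^ N) = C * r ^ k"
    proof -
      have "r ^ N = r ^ d * r ^ k"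
        using assms by (simp add: d_def N_def flip: power_add)
      then show ?thesis using r unfolding C_def by (simp add: power_divide power_mult_distrib)
    qed
    finally show ?thesis .
  qed
  ultimately show ?thesis using that by blast
qed

section \<open>Measurability on the Grassmannian\<close>

lemma openin_Grassmannian_subset:
  "{U. openin (Grassmannian_topology k) U} \<subseteq> Pow (Grassmannian k)"
  by (auto simp: Grassmannian_topology_def openin_pullback_topology)

lemma space_Grassmannian_measure:
  "invariant_Grassmannian_measure k \<gamma> \<Longrightarrow> space \<gamma> = Grassmannian k"
proof -
  have "space (Grassmannian_borel k :: (real^'n) set measure) = Grassmannian k"
    unfolding Grassmannian_borel_def by (rule space_measure_of[OF openin_Grassmannian_subset])
  then show "space \<gamma> = Grassmannian k" if "invariant_Grassmannian_measure k \<gamma>" for \<gamma> :: "(real^'n) set measure"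
    using that sets_eq_imp_space_eq unfolding invariant_Grassmannian_measure_def by blast
qed

lemma matrix_orth_proj_measurable:
  fixes \<gamma> :: "(real^'n) set measure"
  assumes "invariant_Grassmannian_measure k \<gamma>"
  shows "(\<lambda>V. matrix (orth_proj V)) \<in> borel_measurable \<gamma>"
proof (rule borel_measurableI)
  fix S :: "(real^'n^'n) set" assume "open S"
  let ?G = "{U. openin (Grassmannian_topology k) U} :: (real^'n) set set set"
  have "(\<lambda>V. matrix (orth_proj V)) -` S \<inter> Grassmannian k \<in> ?G"
    using \<open>open S\<close> by (auto simp: Grassmannian_topology_def openin_pullback_topology)
  moreover have "?G \<subseteq> sets (sigma (Grassmannian k) ?G)"
    by (auto simp: sets_measure_of[OF openin_Grassmannian_subset])
  ultimately show "(\<lambda>V. matrix (orth_proj V)) -` S \<inter> space \<gamma> \<in> sets \<gamma>"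
    using assms space_Grassmannian_measure[OF assms]
    unfolding invariant_Grassmannian_measure_def Grassmannian_borel_def by auto
qed

text \<open>Joint measurability comes from continuity of the matrix-vector product. The map
  \<open>f\<close> leaves the second factor free, since both Lebesgue measure and the measure
  \<open>\<mu>\<close> living on \<open>X\<close> will occur there.\<close>

lemma orth_proj_measurable:
  fixes \<gamma> :: "(real^'n) set measure"
  assumes "invariant_Grassmannian_measure k \<gamma>" "f \<in> borel_measurable M"
  shows "(\<lambda>(V, x). orth_proj V (f x)) \<in> borel_measurable (\<gamma> \<Otimes>\<^sub>M M)"
proof -
  note [measurable] = matrix_orth_proj_measurable[OF assms(1)] assms(2)
  have "continuous_on UNIV (\<lambda>p :: (real^'n^'n) \<times> (real^'n). fst p *v snd p)"
    unfolding matrix_vector_mult_def by (intro continuous_intros)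
  then have "(\<lambda>p. matrix (orth_proj (fst p)) *v f (snd p)) \<in> borel_measurable (\<gamma> \<Otimes>\<^sub>M M)"
    by (intro borel_measurable_continuous_Pair[where H = "\<lambda>A x. A *v x"]) measurable
  moreover have "matrix (orth_proj (fst p)) *v f (snd p) = (case p of (V, x) \<Rightarrow> orth_proj V (f x))"
    if "p \<in> space (\<gamma> \<Otimes>\<^sub>M M)" for p
  proof -
    have "fst p \<in> space \<gamma>"
      using that by (simp add: space_pair_measure mem_Times_iff)
    then have "subspace (fst p)"
      unfolding space_Grassmannian_measure[OF assms(1)] by (simp add: Grassmannian_def)
    then have "matrix (orth_proj (fst p)) *v f (snd p) = orth_proj (fst p) (f (snd p))"
      using linear_orth_proj[of "fst p"] by simp
    then show ?thesis by (simp add: case_prod_beta)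
  qed
  ultimately show ?thesis by (simp cong: measurable_cong)
qed

lemma orth_proj_measurable_left:
  fixes \<gamma> :: "(real^'n) set measure"
  assumes "invariant_Grassmannian_measure k \<gamma>"
  shows "(\<lambda>V. orth_proj V y) \<in> borel_measurable \<gamma>"
proof -
  have "(\<lambda>V. (V, y)) \<in> measurable \<gamma> (\<gamma> \<Otimes>\<^sub>M borel)" by measurable
  from measurable_comp[OF this orth_proj_measurable[OF assms, of "\<lambda>x. x" borel]]
  show ?thesis by (simp add: comp_def)
qed

subsection \<open>The measure of the planes almost orthogonal to a vector\<close>

text \<open>The exceptional set will be a union over uncountably many points and is not assumed
  measurable. It is trapped in measurable sets of arbitrarily small measure, whose countable
  intersection is null.\<close>

lemma AE_I_outer_null:
  assumes "\<And>e::real. e > 0 \<Longrightarrow> \<exists>B\<in>sets M. emeasure M B \<le> ennreal e \<and> {x\<in>space M. \<not> P x} \<subseteq> B"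
  shows "AE x in M. P x"
proof -
  have "\<forall>n::nat. \<exists>B\<in>sets M. emeasure M B \<le> ennreal (1 / Suc n) \<and> {x\<in>space M. \<not> P x} \<subseteq> B"
    using assms by simp
  then obtain B where B: "\<And>n::nat. B n \<in> sets M" "\<And>n. emeasure M (B n) \<le> ennreal (1 / Suc n)"
    "\<And>n. {x\<in>space M. \<not> P x} \<subseteq> B n"
    by metis
  have le: "emeasure M (\<Inter>n. B n) \<le> ennreal (1 / Suc n)" for n
    using emeasure_mono[of "\<Inter>n. B n" "B n" M] B(1,2)[of n] by (meson INT_lower UNIV_I order_trans)
  have *: "emeasure M (\<Inter>n. B n) \<le> 0 + ennreal e" if "e > 0" for e
  proof -
    obtain n where "1 / real (Suc n) < e"
      using nat_approx_posE[OF \<open>e > 0\<close>] by auto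
    then show ?thesis using le[of n] ennreal_leI[of "1 / real (Suc n)" e] by simp
  qed
  have "emeasure M (\<Inter>n. B n) \<le> 0"
    by (rule ennreal_le_epsilon, rule *)
  then have "(\<Inter>n. B n) \<in> null_sets M"
    using B(1) by (intro null_setsI) auto
  then show ?thesis
    by (rule AE_I') (use B(3) in blast)
qed

text \<open>The condition is homogeneous in the vector, so \<open>y\<close> may be rescaled to the
  length of \<open>z\<close>; an orthogonal map then carries it to \<open>z\<close> and maps one
  event onto the other.\<close>

lemma emeasure_Grassmannian_slab_eq:
  fixes \<gamma> :: "(real^'n) set measure" and y z :: "real^'n"
  assumes "invariant_Grassmannian_measure k \<gamma>" "y \<noteq> 0" "z \<noteq> 0"
  shows "emeasure \<gamma> {V\<in>space \<gamma>. norm (orth_proj V y) \<le> r * norm y} =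
    emeasure \<gamma> {V\<in>space \<gamma>. norm (orth_proj V z) \<le> r * norm z}"
proof -
  note sp = space_Grassmannian_measure[OF assms(1)]
  define c where "c = norm z / norm y"
  have c: "c > 0" using assms(2,3) by (simp add: c_def)
  have "norm (c *\<^sub>R y) = norm z" using assms(2) by (simp add: c_def)
  then obtain Q where Q: "orthogonal_transformation Q" "Q (c *\<^sub>R y) = z"
    using orthogonal_transformation_exists by blast
  let ?A = "{V\<in>space \<gamma>. norm (orth_proj V y) \<le> r * norm y}"
  let ?B = "{V\<in>space \<gamma>. norm (orth_proj V z) \<le> r * norm z}"
  have key: "norm (orth_proj (Q ` V) z) \<le> r * norm z \<longleftrightarrow> norm (orth_proj V y) \<le> r * norm y"
    if "subspace V" for V
  proof -
    have "norm (orth_proj (Q ` V) z) = norm (orth_proj V (c *\<^sub>R y))"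
      using orth_proj_orthogonal_image[OF that Q(1), of "c *\<^sub>R y"] Q(2)
        orthogonal_transformation_norm[OF Q(1)] by simp
    also have "\<dots> = c * norm (orth_proj V y)"
      using c linear_scale[OF linear_orth_proj[OF that]] by simp
    finally show ?thesis
      using \<open>norm (c *\<^sub>R y) = norm z\<close> c by (metis mult.left_commute mult_le_cancel_left_pos abs_of_pos norm_scaleR)
  qed
  have img: "Q ` V \<in> Grassmannian k" if "orthogonal_transformation Q" "V \<in> Grassmannian k"
    for Q :: "real^'n \<Rightarrow> real^'n" and V
  proof -
    note l = orthogonal_transformation_linear[OF that(1)]
    have "dim (Q ` V) = dim V"
      by (rule dim_image_eq[OF l inj_on_subset[OF orthogonal_transformation_inj[OF that(1)]]]) simp
    then show ?thesis
      using that(2) linear_subspace_image[OF l] by (simp add: Grassmannian_def)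
  qed
  have "?B = (\<lambda>V. Q ` V) ` ?A"
  proof (intro equalityI subsetI)
    fix W assume W: "W \<in> ?B"
    let ?V = "inv Q ` W"
    have "?V \<in> Grassmannian k"
      using W sp img[OF orthogonal_transformation_inv[OF Q(1)]] by auto
    moreover have "Q ` ?V = W"
      using orthogonal_transformation_surj[OF Q(1)] by (simp add: image_f_inv_f)
    ultimately have "?V \<in> ?A" using W key[of ?V] sp by (auto simp: Grassmannian_def)
    then show "W \<in> (\<lambda>V. Q ` V) ` ?A" using \<open>Q ` ?V = W\<close> by blast
  next
    fix W assume "W \<in> (\<lambda>V. Q ` V) ` ?A"
    then show "W \<in> ?B" using img[OF Q(1)] key sp by (auto simp: Grassmannian_def)
  qed
  moreover have "?A \<in> sets \<gamma>"
    using orth_proj_measurable_left[OF assms(1), of y] by measurable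
  ultimately show ?thesis
    using assms(1) Q(1) unfolding invariant_Grassmannian_measure_def by auto
qed

text \<open>The measure depends only on \<open>r\<close>, so it may be averaged over \<open>y\<close> in the unit ball; by Tonelli
  the average is controlled by the volume of the slabs \<open>{y. norm (orth_proj V y) \<le> r}\<close>.\<close>

lemma emeasure_Grassmannian_slab_le:
  fixes \<gamma> :: "(real^'n) set measure"
  assumes "invariant_Grassmannian_measure k \<gamma>" "1 \<le> k" "k \<le> CARD('n)"
  obtains C where "C > 0" "\<And>y r. y \<noteq> 0 \<Longrightarrow> 0 \<le> r \<Longrightarrow>
    emeasure \<gamma> {V\<in>space \<gamma>. norm (orth_proj V y) \<le> r * norm y} \<le> ennreal (C * r ^ k)"
proof -
  have ps: "prob_space \<gamma>" using assms(1) unfolding invariant_Grassmannian_measure_def by blast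
  interpret \<gamma>: prob_space \<gamma> by (rule ps)
  interpret P: pair_sigma_finite \<gamma> "lborel :: (real^'n) measure" ..
  note sp = space_Grassmannian_measure[OF assms(1)]
  obtain C0 where C0: "C0 > 0" "\<And>V r. subspace V \<Longrightarrow> dim V = k \<Longrightarrow> 0 < r \<Longrightarrow> r \<le> 1 \<Longrightarrow>
      emeasure lborel {y :: real^'n. norm y \<le> 1 \<and> norm (orth_proj V y) \<le> r} \<le> ennreal (C0 * r ^ k)"
    using slab_volume[OF assms(3)] by blast
  define u where "u = unit_ball_vol (real CARD('n))"
  have u: "u > 0" unfolding u_def by simp
  let ?f = "\<lambda>r y. emeasure \<gamma> {V\<in>space \<gamma>. norm (orth_proj V y) \<le> r * norm y}"
  have main: "?f r y \<le> ennreal (C0 / u * r ^ k)" if y: "y \<noteq> 0" and r: "0 < r" "r \<le> 1" for y r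
  proof -
    \<comment> \<open>The section of \<open>?A\<close> at a nonzero \<open>z\<close> of the unit
      ball has the measure to be estimated, while its section at \<open>V\<close> lies in the set of
      \<open>slab_volume\<close>. Computing the product measure in both orders compares the
      two.\<close>
    let ?A = "{p \<in> space (\<gamma> \<Otimes>\<^sub>M lborel). norm (snd p) \<le> 1 \<and> norm (orth_proj (fst p) (snd p)) \<le> r * norm (snd p)}"
    have "(\<lambda>p. orth_proj (fst p) (snd p)) \<in> borel_measurable (\<gamma> \<Otimes>\<^sub>M lborel)"
      using orth_proj_measurable[OF assms(1), of "\<lambda>x. x" lborel] by (simp add: case_prod_beta)
    then have A: "?A \<in> sets (\<gamma> \<Otimes>\<^sub>M lborel)" by measurable
    have "ennreal u * ?f r y = (\<integral>\<^sup>+z. ?f r y * indicator (cball (0 :: real^'n) 1) z \<partial>lborel)"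
      by (subst nn_integral_cmult_indicator) (simp_all add: emeasure_cball u_def mult.commute)
    also have "\<dots> \<le> (\<integral>\<^sup>+z. emeasure \<gamma> ((\<lambda>V. (V, z)) -` ?A) \<partial>lborel)"
    proof (rule nn_integral_mono_AE)
      \<comment> \<open>The origin must be left out: every plane satisfies the condition for the
        zero vector.\<close>
      have "AE z in lborel. z \<noteq> (0 :: real^'n)"
        by (rule AE_lborel_singleton)
      then show "AE z in lborel. ?f r y * indicator (cball 0 1) z \<le> emeasure \<gamma> ((\<lambda>V. (V, z)) -` ?A)"
      proof eventually_elim
        case (elim z)
        have "?f r y = ?f r z"
          by (rule emeasure_Grassmannian_slab_eq[OF assms(1) y elim])
        moreover have "(\<lambda>V. (V, z)) -` ?A = {V\<in>space \<gamma>. norm (orth_proj V z) \<le> r * norm z}" if "norm z \<le> 1"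
          using that by (auto simp: space_pair_measure)
        ultimately show ?case by (auto simp: indicator_def)
      qed
    qed
    also have "\<dots> = emeasure (\<gamma> \<Otimes>\<^sub>M lborel) ?A"
      by (rule P.emeasure_pair_measure_alt2[OF A, symmetric])
    also have "\<dots> = (\<integral>\<^sup>+V. emeasure lborel (Pair V -` ?A) \<partial>\<gamma>)"
      by (rule lborel.emeasure_pair_measure_alt[OF A])
    also have "\<dots> \<le> (\<integral>\<^sup>+V. ennreal (C0 * r ^ k) \<partial>\<gamma>)"
    proof (rule nn_integral_mono)
      fix V assume V: "V \<in> space \<gamma>"
      then have sV: "subspace V" "dim V = k" using sp by (auto simp: Grassmannian_def)
      have "Pair V -` ?A \<subseteq> {y. norm y \<le> 1 \<and> norm (orth_proj V y) \<le> r}"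
      proof
        fix z assume "z \<in> Pair V -` ?A"
        then have z: "norm z \<le> 1" "norm (orth_proj V z) \<le> r * norm z" by auto
        then have "norm (orth_proj V z) \<le> r" using mult_left_mono[of "norm z" 1 r] r by linarith
        then show "z \<in> {y. norm y \<le> 1 \<and> norm (orth_proj V y) \<le> r}" using z by simp
      qed
      moreover have "{y. norm y \<le> 1 \<and> norm (orth_proj V y) \<le> r} \<in> sets lborel"
      proof -
        have "continuous_on UNIV (orth_proj V)"
          using linear_orth_proj[OF sV(1)] linear_continuous_on linear_conv_bounded_linear by blast
        then have [measurable]: "orth_proj V \<in> borel_measurable borel"
          by (rule borel_measurable_continuous_onI)
        show ?thesis by measurable
      qed
      ultimately have "emeasure lborel (Pair V -` ?A) \<le>
          emeasure lborel {y. norm y \<le> 1 \<and> norm (orth_proj V y) \<le> r}"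
        by (rule emeasure_mono)
      also have "\<dots> \<le> ennreal (C0 * r ^ k)" by (rule C0(2)[OF sV r])
      finally show "emeasure lborel (Pair V -` ?A) \<le> ennreal (C0 * r ^ k)" .
    qed
    also have "\<dots> = ennreal (C0 * r ^ k)" by (simp add: \<gamma>.emeasure_space_1)
    finally have "ennreal u * ?f r y \<le> ennreal (C0 * r ^ k)" .
    then have "u * measure \<gamma> {V\<in>space \<gamma>. norm (orth_proj V y) \<le> r * norm y} \<le> C0 * r ^ k"
      using u r C0(1) by (simp add: \<gamma>.emeasure_eq_measure flip: ennreal_mult')
    then show ?thesis
      using u by (simp add: \<gamma>.emeasure_eq_measure ennreal_leI field_simps)
  qed
  \<comment> \<open>The lower bound \<open>1\<close> covers \<open>r > 1\<close>, where the total
    mass is the only available bound.\<close>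
  define C where "C = max 1 (C0 / u)"
  have "C > 0" unfolding C_def by simp
  moreover have "?f r y \<le> ennreal (C * r ^ k)" if y: "y \<noteq> 0" and r: "0 \<le> r" for y r
  proof -
    consider "r > 1" | "0 < r" "r \<le> 1" | "r = 0" using r by linarith
    then show ?thesis
    proof cases
      case 1
      have "1 \<le> C" unfolding C_def by simp
      moreover have "1 \<le> r ^ k" using 1 by (intro one_le_power) simp
      ultimately have "1 * 1 \<le> C * r ^ k"
        by (intro mult_mono) auto
      then have "1 \<le> ennreal (C * r ^ k)"
        using ennreal_leI[of 1 "C * r ^ k"] by simp
      then show ?thesis
        by (rule order_trans[OF \<gamma>.emeasure_le_1])
    next
      case 2
      have "C0 / u * r ^ k \<le> C * r ^ k"
        using 2 by (intro mult_right_mono) (auto simp: C_def)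
      then show ?thesis using main[OF y 2] ennreal_leI order_trans by blast
    next
      case 3
      have *: "?f 0 y \<le> 0 + ennreal e" if "e > 0" for e
      proof -
        \<comment> \<open>The event for \<open>r = 0\<close> lies in the one for every
          \<open>s > 0\<close>, whose bound tends to \<open>0\<close> because
          \<open>s ^ k \<le> s\<close>. Radius zero does occur in the covers used later.\<close>
        define s where "s = min 1 (e / C)"
        have s: "0 < s" "s \<le> 1" "C * s \<le> e"
          using that \<open>C > 0\<close> by (auto simp: s_def min_def field_simps)
        have "s ^ k \<le> s ^ 1" using s assms(2) by (intro power_decreasing) auto
        then have "C0 / u * s ^ k \<le> C * s"
          using s C0(1) u by (intro mult_mono) (auto simp: C_def)
        then have "ennreal (C0 / u * s ^ k) \<le> ennreal e" using s(3) by (intro ennreal_leI) simp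
        moreover have "?f 0 y \<le> ?f s y"
        proof (rule emeasure_mono)
          show "{V\<in>space \<gamma>. norm (orth_proj V y) \<le> s * norm y} \<in> sets \<gamma>"
            using orth_proj_measurable_left[OF assms(1), of y] by measurable
        qed (use s in \<open>auto intro: order_trans[OF _ mult_nonneg_nonneg]\<close>)
        ultimately show ?thesis using main[OF y s(1,2)] by simp
      qed
      have "?f 0 y \<le> 0" by (rule ennreal_le_epsilon, rule *)
      then show ?thesis using 3 assms(2) by simp
    qed
  qed
  ultimately show ?thesis using that by blast
qed

subsection \<open>Projections of null sets\<close>

text \<open>The form of nullity that a union bound over planes consumes: balls whose radii have
  small \<open>k\<close>-th powers in total. Centres may lie outside \<open>S\<close>, and radii may
  vanish.\<close>

definition null_cover :: "nat \<Rightarrow> 'a::metric_space set \<Rightarrow> bool" where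
  "null_cover k S \<longleftrightarrow> (\<forall>e>0. \<exists>(y :: nat \<Rightarrow> 'a) d. (\<forall>i. 0 \<le> d i) \<and>
     S \<subseteq> (\<Union>i. cball (y i) (d i)) \<and> (\<Sum>i. ennreal (d i ^ k)) \<le> ennreal e)"

text \<open>The premeasure at mesh \<open>1\<close> is below the Hausdorff measure, hence zero. Each
  nonempty covering set lies in the ball around any of its points with radius its diameter.\<close>

lemma null_cover_if_hausdorff_null:
  fixes S :: "'a::metric_space set"
  assumes "1 \<le> k" "hausdorff_measure k S = 0"
  shows "null_cover k S"
  unfolding null_cover_def
proof (intro allI impI)
  fix e :: real assume e: "e > 0"
  \<comment> \<open>The factor between the \<open>k\<close>-th power of a diameter and its
    contribution to the premeasure.\<close>
  define c where "c = unit_ball_vol (real k) / 2 ^ k"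
  have c: "c > 0" by (simp add: c_def)
  have "hausdorff_premeasure k 1 S \<le> hausdorff_measure k S"
    unfolding hausdorff_measure_def by (rule SUP_upper) simp
  then have "hausdorff_premeasure k 1 S < ennreal (c * e)"
    using assms(2) c e by simp
  then obtain U :: "nat \<Rightarrow> 'a set" where U: "S \<subseteq> (\<Union>i. U i)" "\<And>i. bounded (U i)"
    "(\<Sum>i. if U i = {} then 0 else ennreal (unit_ball_vol (real k) * (diameter (U i) / 2) ^ k)) < ennreal (c * e)"
    unfolding hausdorff_premeasure_def INF_less_iff by auto
  \<comment> \<open>Empty sets get radius zero and contribute \<open>0 ^ k\<close>, which agrees
    with the premeasure because \<open>1 \<le> k\<close>.\<close>
  define d where "d i = (if U i = {} then 0 else diameter (U i))" for i
  define y where "y i = (SOME x. x \<in> U i)" for i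
  have d: "0 \<le> d i" for i
    using diameter_ge_0[OF U(2)] by (simp add: d_def)
  have "U i \<subseteq> cball (y i) (d i)" for i
  proof
    fix x assume x: "x \<in> U i"
    then have "y i \<in> U i" unfolding y_def by (rule someI)
    from diameter_bounded_bound[OF U(2) this x] show "x \<in> cball (y i) (d i)"
      using x by (auto simp: d_def)
  qed
  then have "S \<subseteq> (\<Union>i. cball (y i) (d i))"
    by (intro order_trans[OF U(1)] UN_mono subset_refl)
  moreover have "(\<Sum>i. ennreal (d i ^ k)) \<le> ennreal e"
  proof -
    have "ennreal c * (\<Sum>i. ennreal (d i ^ k)) = (\<Sum>i. ennreal c * ennreal (d i ^ k))"
      by (rule ennreal_suminf_cmult[symmetric])
    also have "\<dots> = (\<Sum>i. if U i = {} then 0 else ennreal (unit_ball_vol (real k) * (diameter (U i) / 2) ^ k))"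
    proof (rule suminf_cong)
      fix i
      have "ennreal c * ennreal (d i ^ k) = ennreal (c * d i ^ k)"
        using c d[of i] by (simp add: ennreal_mult')
      then show "ennreal c * ennreal (d i ^ k) =
          (if U i = {} then 0 else ennreal (unit_ball_vol (real k) * (diameter (U i) / 2) ^ k))"
        using assms(1) by (auto simp: d_def c_def power_divide power_0_left)
    qed
    also have "\<dots> \<le> ennreal (c * e)" using U(3) by simp
    also have "\<dots> = ennreal c * ennreal e" using c by (simp add: ennreal_mult')
    finally show ?thesis using c by (simp add: ennreal_mult_le_mult_iff)
  qed
  ultimately show "\<exists>(y :: nat \<Rightarrow> 'a) d. (\<forall>i. 0 \<le> d i) \<and>
     S \<subseteq> (\<Union>i. cball (y i) (d i)) \<and> (\<Sum>i. ennreal (d i ^ k)) \<le> ennreal e"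
    using d by blast
qed

section \<open>Box-counting bounds\<close>

text \<open>A quantitative form of upper box dimension at most \<open>d\<close>: of order
  \<open>n ^ d\<close> balls of radius of order \<open>1 / n\<close>, at every scale. A single
  \<open>C\<close> bounds both count and radius, so later operations merely enlarge it.\<close>

definition box_cover :: "nat \<Rightarrow> 'a::metric_space set \<Rightarrow> bool" where
  "box_cover d S \<longleftrightarrow> (\<exists>C::real\<ge>0. \<forall>n::nat\<ge>1. \<exists>F. finite F \<and> real (card F) \<le> C * real n ^ d \<and>
     (\<forall>x\<in>S. \<exists>y\<in>F. dist x y \<le> C / real n))"

lemma box_cover_subset: "box_cover d S \<Longrightarrow> T \<subseteq> S \<Longrightarrow> box_cover d T"
  unfolding box_cover_def by (meson subsetD)

text \<open>At scale \<open>n\<close> the total is at most \<open>C * n ^ d * (C / n) ^ k\<close>,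
  hence at most \<open>C ^ Suc k / n\<close> since \<open>d < k\<close>; this dictates the choice of
  \<open>n\<close>.\<close>

lemma null_cover_if_box_cover:
  fixes S :: "'a::metric_space set"
  assumes "box_cover d S" "d < k"
  shows "null_cover k S"
  unfolding null_cover_def
proof (intro allI impI)
  fix e :: real assume e: "e > 0"
  obtain C where C: "C \<ge> 0" "\<And>n::nat. n \<ge> 1 \<Longrightarrow> \<exists>F. finite F \<and> real (card F) \<le> C * real n ^ d \<and>
     (\<forall>x\<in>S. \<exists>y\<in>F. dist x y \<le> C / real n)"
    using assms(1) unfolding box_cover_def by auto
  obtain n :: nat where n: "n \<ge> 1" "C ^ Suc k / e \<le> real n"
  proof -
    obtain n :: nat where "C ^ Suc k / e \<le> real n" using real_arch_simple by blast
    then show ?thesis using that[of "max 1 n"] by auto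
  qed
  obtain F where F: "finite F" "real (card F) \<le> C * real n ^ d" "\<forall>x\<in>S. \<exists>y\<in>F. dist x y \<le> C / real n"
    using C(2)[OF n(1)] by auto
  obtain h where h: "bij_betw h {..<card F} F"
    using F(1) ex_bij_betw_nat_finite[of F] by (auto simp: atLeast0LessThan)
  \<comment> \<open>The finite cover is padded to a sequence by balls of radius zero, which add
    nothing since \<open>k > 0\<close>.\<close>
  define \<delta> where "\<delta> i = (if i < card F then C / real n else 0)" for i
  have "S \<subseteq> (\<Union>i. cball (h i) (\<delta> i))"
  proof
    fix x assume "x \<in> S"
    then obtain y where y: "y \<in> F" "dist x y \<le> C / real n" using F(3) by blast
    from y(1) h have "y \<in> h ` {..<card F}" by (simp add: bij_betw_def)
    then obtain i where "i < card F" "h i = y" by auto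
    then have "x \<in> cball (h i) (\<delta> i)" using y by (simp add: \<delta>_def dist_commute)
    then show "x \<in> (\<Union>i. cball (h i) (\<delta> i))" by blast
  qed
  moreover have "(\<Sum>i. ennreal (\<delta> i ^ k)) \<le> ennreal e"
  proof -
    have "(\<Sum>i. ennreal (\<delta> i ^ k)) = (\<Sum>i<card F. ennreal (\<delta> i ^ k))"
      using assms(2) by (intro suminf_finite) (auto simp: \<delta>_def)
    also have "\<dots> = ennreal (real (card F) * (C / real n) ^ k)"
      by (simp add: \<delta>_def ennreal_mult' C(1) ennreal_of_nat_eq_real_of_nat)
    also have "\<dots> \<le> ennreal e"
    proof (rule ennreal_leI)
      have "real (card F) * (C / real n) ^ k \<le> C * real n ^ d * (C / real n) ^ k"
        using F(2) C(1) by (intro mult_right_mono) auto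
      also have "\<dots> = C ^ Suc k * (real n ^ d / real n ^ k)"
        by (simp add: power_divide)
      also have "real n ^ d / real n ^ k = 1 / real n ^ (k - d)"
        using assms(2) n(1) by (simp add: power_diff field_simps)
      also have "C ^ Suc k * (1 / real n ^ (k - d)) \<le> C ^ Suc k * (1 / real n)"
      proof (intro mult_left_mono divide_left_mono)
        show "real n \<le> real n ^ (k - d)"
          using n(1) assms(2) by (intro self_le_power) auto
      qed (use n(1) C(1) in auto)
      also have "\<dots> \<le> e"
        using n e by (simp add: field_simps)
      finally show "real (card F) * (C / real n) ^ k \<le> e" .
    qed
    finally show ?thesis .
  qed
  moreover have "\<forall>i. 0 \<le> \<delta> i" using C(1) by (simp add: \<delta>_def)
  ultimately show "\<exists>(y :: nat \<Rightarrow> 'a) d. (\<forall>i. 0 \<le> d i) \<and>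
     S \<subseteq> (\<Union>i. cball (y i) (d i)) \<and> (\<Sum>i. ennreal (d i ^ k)) \<le> ennreal e"
    by blast
qed

lemma box_cover_cube:
  fixes B :: "'a::real_normed_vector set"
  assumes "finite B" "\<And>b. b \<in> B \<Longrightarrow> norm b \<le> 1"
  shows "box_cover (card B) {\<Sum>b\<in>B. c b *\<^sub>R b | c. \<forall>b\<in>B. \<bar>c b\<bar> \<le> 1}"
proof -
  \<comment> \<open>\<open>3 ^ card B\<close> comes from \<open>2 * n + 1 \<le> 3 * n\<close>;
    \<open>card B\<close> is the radius factor of the grid.\<close>
  define C :: real where "C = max (3 ^ card B) (card B)"
  have "\<exists>F. finite F \<and> real (card F) \<le> C * real n ^ card B \<and>
     (\<forall>x\<in>{\<Sum>b\<in>B. c b *\<^sub>R b | c. \<forall>b\<in>B. \<bar>c b\<bar> \<le> 1}. \<exists>y\<in>F. dist x y \<le> C / real n)"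
    if n: "n \<ge> 1" for n
  proof -
    obtain F where F: "finite F" "card F \<le> (2 * n + 1) ^ card B"
      "\<And>c. (\<forall>b\<in>B. \<bar>c b\<bar> \<le> 1) \<Longrightarrow> (\<exists>y\<in>F. norm ((\<Sum>b\<in>B. c b *\<^sub>R b) - y) \<le> real (card B) / real n)"
      using cube_cover[OF assms n] by auto
    have "real (card F) \<le> real ((2 * n + 1) ^ card B)"
      using F(2) of_nat_le_iff by blast
    also have "\<dots> \<le> real ((3 * n) ^ card B)"
      using n by (intro of_nat_mono power_mono) auto
    also have "\<dots> = 3 ^ card B * real n ^ card B"
      by (simp add: power_mult_distrib)
    also have "\<dots> \<le> C * real n ^ card B"
      by (intro mult_right_mono) (auto simp: C_def)
    finally have 1: "real (card F) \<le> C * real n ^ card B" .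
    have 2: "real (card B) / real n \<le> C / real n"
      by (intro divide_right_mono) (auto simp: C_def)
    have "\<exists>y\<in>F. dist x y \<le> C / real n" if x: "x \<in> {\<Sum>b\<in>B. c b *\<^sub>R b | c. \<forall>b\<in>B. \<bar>c b\<bar> \<le> 1}" for x
    proof -
      obtain c where "x = (\<Sum>b\<in>B. c b *\<^sub>R b)" "\<forall>b\<in>B. \<bar>c b\<bar> \<le> 1" using x by blast
      then obtain y where "y \<in> F" "norm (x - y) \<le> real (card B) / real n" using F(3)[of c] by blast
      then show ?thesis using 2 by (auto simp: dist_norm intro: order_trans)
    qed
    then show ?thesis using F(1) 1 by blast
  qed
  moreover have "C \<ge> 0" by (simp add: C_def)
  ultimately show ?thesis unfolding box_cover_def by blast
qed

text \<open>The Lipschitz bound holds on \<open>S\<close> only, while the centres of the cover may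
  lie outside \<open>S\<close>. Each useful centre is replaced by a point of \<open>S\<close> in its
  ball, which doubles the radius.\<close>

lemma box_cover_lipschitz_image:
  fixes f :: "'a::metric_space \<Rightarrow> 'b::metric_space"
  assumes "box_cover d S" "\<And>x y. x \<in> S \<Longrightarrow> y \<in> S \<Longrightarrow> dist (f x) (f y) \<le> L * dist x y"
  shows "box_cover d (f ` S)"
proof -
  obtain C where C: "C \<ge> 0" "\<And>n::nat. n \<ge> 1 \<Longrightarrow> \<exists>F. finite F \<and> real (card F) \<le> C * real n ^ d \<and>
     (\<forall>x\<in>S. \<exists>y\<in>F. dist x y \<le> C / real n)"
    using assms(1) unfolding box_cover_def by auto
  define K where "K = max C (\<bar>L\<bar> * (2 * C))"
  have "\<exists>F. finite F \<and> real (card F) \<le> K * real n ^ d \<and>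
     (\<forall>x\<in>f ` S. \<exists>y\<in>F. dist x y \<le> K / real n)" if n: "n \<ge> 1" for n
  proof -
    obtain F where F: "finite F" "real (card F) \<le> C * real n ^ d" "\<forall>x\<in>S. \<exists>y\<in>F. dist x y \<le> C / real n"
      using C(2)[OF n] by auto
    define s where "s y = (SOME x. x \<in> S \<and> dist x y \<le> C / real n)" for y
    have s: "s y \<in> S" "dist (s y) y \<le> C / real n" if "x \<in> S" "dist x y \<le> C / real n" for x y
      using someI[of "\<lambda>x. x \<in> S \<and> dist x y \<le> C / real n" x] that unfolding s_def by auto
    let ?F = "(\<lambda>y. f (s y)) ` F"
    have "real (card ?F) \<le> real (card F)" using card_image_le[OF F(1)] by simp
    also have "\<dots> \<le> K * real n ^ d"
      by (rule order_trans[OF F(2)], rule mult_right_mono) (auto simp: K_def)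
    finally have "real (card ?F) \<le> K * real n ^ d" .
    moreover have "\<exists>z\<in>?F. dist (f x) z \<le> K / real n" if x: "x \<in> S" for x
    proof -
      obtain y where y: "y \<in> F" "dist x y \<le> C / real n" using F(3) x by blast
      have "dist x (s y) \<le> 2 * C / real n"
        using dist_triangle2[of x "s y" y] y(2) s(2)[OF x y(2)] by simp
      then have "\<bar>L\<bar> * dist x (s y) \<le> \<bar>L\<bar> * (2 * C / real n)" by (rule mult_left_mono) simp
      also have "\<dots> \<le> K / real n" using n by (simp add: K_def divide_right_mono)
      finally have "\<bar>L\<bar> * dist x (s y) \<le> K / real n" .
      moreover have "L * dist x (s y) \<le> \<bar>L\<bar> * dist x (s y)" by (rule mult_right_mono) auto
      ultimately have "dist (f x) (f (s y)) \<le> K / real n"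
        using assms(2)[OF x s(1)[OF x y(2)]] by linarith
      then show ?thesis using y(1) by blast
    qed
    ultimately show ?thesis using F(1) by blast
  qed
  moreover have "K \<ge> 0" using C(1) by (simp add: K_def)
  ultimately show ?thesis unfolding box_cover_def by blast
qed

section \<open>Almost sure injectivity seen from one point\<close>

text \<open>If \<open>w\<close> has the same projection as \<open>x\<close> and \<open>s\<close>
  lies in the same covering ball as \<open>w\<close>, then \<open>s - x\<close> projects to length
  at most \<open>2 * d i\<close>. So \<open>V\<close> belongs to an event of measure of order
  \<open>d i ^ k\<close>, and these measures are summed over the cover. The constant is uniform only
  at distance at least \<open>1 / j\<close> from \<open>x\<close>, whence the countable exhaustion
  over \<open>j\<close>.\<close>

lemma AE_orth_proj_inj:
  fixes \<gamma> :: "(real^'n) set measure"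
  assumes "invariant_Grassmannian_measure k \<gamma>" "1 \<le> k" "k \<le> CARD('n)" "null_cover k S"
  shows "AE V in \<gamma>. \<forall>y\<in>S. y \<noteq> x \<longrightarrow> orth_proj V y \<noteq> orth_proj V x"
proof -
  obtain C where C: "C > 0" "\<And>y r. y \<noteq> 0 \<Longrightarrow> 0 \<le> r \<Longrightarrow>
    emeasure \<gamma> {V\<in>space \<gamma>. norm (orth_proj V y) \<le> r * norm y} \<le> ennreal (C * r ^ k)"
    using emeasure_Grassmannian_slab_le[OF assms(1-3)] by blast
  have "AE V in \<gamma>. \<forall>y\<in>S. 1 \<le> real j * norm (y - x) \<longrightarrow> orth_proj V y \<noteq> orth_proj V x" for j :: nat
  proof (rule AE_I_outer_null)
    fix e :: real assume e: "e > 0"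
    \<comment> \<open>The geometry gives the factor \<open>2 * j\<close>; adding \<open>1\<close>
      keeps \<open>c\<close> positive for \<open>j = 0\<close>, where the condition on the points is
      void.\<close>
    define c where "c = C * (2 * real j + 1) ^ k"
    have c: "c > 0" using C(1) by (simp add: c_def)
    then have "e / c > 0" using e by simp
    then obtain y :: "nat \<Rightarrow> real^'n" and d where yd: "\<And>i. 0 \<le> d i" "S \<subseteq> (\<Union>i. cball (y i) (d i))"
      "(\<Sum>i. ennreal (d i ^ k)) \<le> ennreal (e / c)"
      using assms(4) unfolding null_cover_def by metis
    \<comment> \<open>The centre \<open>y i\<close> may be \<open>x\<close> or close to it, so each
      ball is represented by one of its points far enough from \<open>x\<close>; balls without such
      a point are dropped.\<close>
    define Q where "Q i s \<longleftrightarrow> s \<in> cball (y i) (d i) \<and> 1 \<le> real j * norm (s - x)" for i s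
    define s where "s i = (SOME s. Q i s)" for i
    define B where "B i = (if \<exists>s. Q i s then
      {V\<in>space \<gamma>. norm (orth_proj V (s i - x)) \<le> ((2 * real j + 1) * d i) * norm (s i - x)} else {})" for i
    have Bs: "B i \<in> sets \<gamma>" for i
    proof -
      have "{V\<in>space \<gamma>. norm (orth_proj V (s i - x)) \<le> ((2 * real j + 1) * d i) * norm (s i - x)} \<in> sets \<gamma>"
        using orth_proj_measurable_left[OF assms(1), of "s i - x"] by measurable
      then show ?thesis by (cases "\<exists>s. Q i s") (simp_all only: B_def if_True if_False sets.empty_sets)
    qed
    have Bm: "emeasure \<gamma> (B i) \<le> ennreal c * ennreal (d i ^ k)" for i
    proof (cases "\<exists>s. Q i s")
      case True
      then have "Q i (s i)" unfolding s_def by (rule someI_ex)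
      then have "s i - x \<noteq> 0" by (auto simp: Q_def)
      then have "emeasure \<gamma> (B i) \<le> ennreal (C * ((2 * real j + 1) * d i) ^ k)"
        using C(2)[of "s i - x" "(2 * real j + 1) * d i"] yd(1)[of i] True by (simp add: B_def)
      also have "C * ((2 * real j + 1) * d i) ^ k = c * d i ^ k"
        by (simp add: c_def power_mult_distrib)
      finally show ?thesis using c yd(1)[of i] by (simp add: ennreal_mult')
    qed (simp add: B_def)
    have "emeasure \<gamma> (\<Union>i. B i) \<le> (\<Sum>i. emeasure \<gamma> (B i))"
      using Bs by (intro emeasure_subadditive_countably) auto
    also have "\<dots> \<le> (\<Sum>i. ennreal c * ennreal (d i ^ k))"
      by (intro suminf_le Bm) auto
    also have "\<dots> = ennreal c * (\<Sum>i. ennreal (d i ^ k))"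
      by (rule ennreal_suminf_cmult)
    also have "\<dots> \<le> ennreal c * ennreal (e / c)"
      by (rule mult_left_mono[OF yd(3)]) simp
    also have "\<dots> = ennreal e" using c by (simp flip: ennreal_mult')
    finally have "emeasure \<gamma> (\<Union>i. B i) \<le> ennreal e" .
    moreover have "{V\<in>space \<gamma>. \<not> (\<forall>y\<in>S. 1 \<le> real j * norm (y - x) \<longrightarrow> orth_proj V y \<noteq> orth_proj V x)}
        \<subseteq> (\<Union>i. B i)"
    proof
      fix V assume "V \<in> {V\<in>space \<gamma>. \<not> (\<forall>y\<in>S. 1 \<le> real j * norm (y - x) \<longrightarrow> orth_proj V y \<noteq> orth_proj V x)}"
      then obtain w where V: "V \<in> space \<gamma>" and w: "w \<in> S" "1 \<le> real j * norm (w - x)" "orth_proj V w = orth_proj V x"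
        by auto
      have sV: "subspace V"
        using V space_Grassmannian_measure[OF assms(1)] by (auto simp: Grassmannian_def)
      note l = linear_orth_proj[OF sV]
      obtain i where i: "w \<in> cball (y i) (d i)" using w(1) yd(2) by blast
      then have ex: "\<exists>s. Q i s" using w(2) by (auto simp: Q_def)
      then have si: "Q i (s i)" unfolding s_def by (rule someI_ex)
      have "norm (orth_proj V (s i - x)) = norm (orth_proj V (s i - w))"
        using w(3) by (simp add: linear_diff[OF l])
      also have "\<dots> \<le> norm (s i - w)" by (rule norm_orth_proj_le(1)[OF sV])
      also have "\<dots> \<le> 2 * d i"
        using i si dist_triangle2[of "s i" w "y i"] by (simp add: Q_def dist_norm norm_minus_commute)
      also have "\<dots> \<le> 2 * d i * (real j * norm (s i - x))"
        using si yd(1)[of i] mult_left_mono[of 1 "real j * norm (s i - x)" "2 * d i"] by (simp add: Q_def)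
      also have "\<dots> \<le> ((2 * real j + 1) * d i) * norm (s i - x)"
        using yd(1)[of i] by (simp add: algebra_simps)
      finally have "V \<in> B i" using V ex by (simp add: B_def)
      then show "V \<in> (\<Union>i. B i)" by blast
    qed
    moreover have "(\<Union>i. B i) \<in> sets \<gamma>" using Bs by auto
    ultimately show "\<exists>B\<in>sets \<gamma>. emeasure \<gamma> B \<le> ennreal e \<and>
      {V\<in>space \<gamma>. \<not> (\<forall>y\<in>S. 1 \<le> real j * norm (y - x) \<longrightarrow> orth_proj V y \<noteq> orth_proj V x)} \<subseteq> B"
      by blast
  qed
  then have "AE V in \<gamma>. \<forall>j::nat. \<forall>y\<in>S. 1 \<le> real j * norm (y - x) \<longrightarrow> orth_proj V y \<noteq> orth_proj V x"
    by (simp add: AE_all_countable)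
  then show ?thesis
  proof eventually_elim
    case (elim V)
    show ?case
    proof (intro ballI impI)
      fix y assume y: "y \<in> S" "y \<noteq> x"
      then have p: "norm (y - x) > 0" by simp
      obtain j :: nat where "1 / norm (y - x) \<le> real j" using real_arch_simple by blast
      then have "1 \<le> real j * norm (y - x)" using p by (simp add: divide_le_eq)
      then show "orth_proj V y \<noteq> orth_proj V x" using elim y(1) by blast
    qed
  qed
qed

text \<open>A subspace is the cone over the faces of a cube, whose dimension is smaller than \<open>k\<close>.\<close>

lemma AE_orth_proj_inj_subspace:
  fixes \<gamma> :: "(real^'n) set measure"
  assumes "invariant_Grassmannian_measure k \<gamma>" "1 \<le> k" "k \<le> CARD('n)" "subspace T" "dim T \<le> k"
  shows "AE V in \<gamma>. \<forall>t\<in>T. orth_proj V t = 0 \<longrightarrow> t = 0"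
proof -
  obtain B where B: "B \<subseteq> T" "pairwise orthogonal B" "\<And>b. b \<in> B \<Longrightarrow> norm b = 1"
      "independent B" "card B = dim T" "span B = T"
    using orthonormal_basis_subspace[OF assms(4)] by blast
  have finB: "finite B" using B(4) independent_imp_finite by blast
  \<comment> \<open>Translated by \<open>b\<close>, this is the face of the cube whose
    \<open>b\<close>-coordinate is \<open>1\<close>. The rescaling below may be negative, which
    takes care of the opposite face.\<close>
  define Q where "Q b = {\<Sum>a\<in>B - {b}. c a *\<^sub>R a | c. \<forall>a\<in>B - {b}. \<bar>c a\<bar> \<le> 1}" for b
  have "AE V in \<gamma>. \<forall>s\<in>(\<lambda>q. b + q) ` Q b. s \<noteq> 0 \<longrightarrow> orth_proj V s \<noteq> orth_proj V 0" if b: "b \<in> B" for b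
  proof (rule AE_orth_proj_inj[OF assms(1-3)], rule null_cover_if_box_cover)
    have "box_cover (card (B - {b})) (Q b)"
      unfolding Q_def using finB B(3) by (intro box_cover_cube) auto
    then show "box_cover (card (B - {b})) ((\<lambda>q. b + q) ` Q b)"
      by (rule box_cover_lipschitz_image[of _ _ _ 1]) simp
    show "card (B - {b}) < k"
      using b finB B(5) assms(5) card_Diff1_less[OF finB b] by linarith
  qed
  then have "AE V in \<gamma>. \<forall>b\<in>B. \<forall>s\<in>(\<lambda>q. b + q) ` Q b. s \<noteq> 0 \<longrightarrow> orth_proj V s \<noteq> orth_proj V 0"
    by (intro AE_finite_allI[OF finB])
  with AE_space show ?thesis
  proof eventually_elim
    case (elim V)
    have sV: "subspace V"
      using elim(1) space_Grassmannian_measure[OF assms(1)] by (auto simp: Grassmannian_def)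
    note l = linear_orth_proj[OF sV]
    show ?case
    proof (intro ballI impI, rule ccontr)
      fix t assume t: "t \<in> T" "orth_proj V t = 0" "t \<noteq> 0"
      have ex: "(\<Sum>b\<in>B. (t \<bullet> b) *\<^sub>R b) = t"
        by (rule orthonormal_basis_expand[OF B(2,3) _ finB]) (use t B(6) in auto)
      then have "B \<noteq> {}" using t(3) by auto
      \<comment> \<open>Dividing \<open>t\<close> by a coordinate of largest absolute value puts it
        on the corresponding face.\<close>
      then have "Max ((\<lambda>a. \<bar>t \<bullet> a\<bar>) ` B) \<in> (\<lambda>a. \<bar>t \<bullet> a\<bar>) ` B"
        using finB by (intro Max_in) auto
      then obtain b where "b \<in> B" "Max ((\<lambda>a. \<bar>t \<bullet> a\<bar>) ` B) = \<bar>t \<bullet> b\<bar>" by auto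
      then have b: "b \<in> B" "\<And>a. a \<in> B \<Longrightarrow> \<bar>t \<bullet> a\<bar> \<le> \<bar>t \<bullet> b\<bar>"
        using finB Max_ge[of "(\<lambda>a. \<bar>t \<bullet> a\<bar>) ` B"] by auto
      have tb: "t \<bullet> b \<noteq> 0"
      proof
        assume "t \<bullet> b = 0"
        then have "\<And>a. a \<in> B \<Longrightarrow> t \<bullet> a = 0" using b(2) by fastforce
        then have "(\<Sum>b\<in>B. (t \<bullet> b) *\<^sub>R b) = 0" by (simp add: sum.neutral)
        then show False using ex t(3) by simp
      qed
      define s where "s = (1 / (t \<bullet> b)) *\<^sub>R t"
      have "s = (\<Sum>a\<in>B. ((t \<bullet> a) / (t \<bullet> b)) *\<^sub>R a)"
        unfolding s_def by (subst ex[symmetric]) (simp add: scaleR_sum_right)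
      also have "\<dots> = b + (\<Sum>a\<in>B - {b}. ((t \<bullet> a) / (t \<bullet> b)) *\<^sub>R a)"
        using sum.remove[OF finB b(1), of "\<lambda>a. ((t \<bullet> a) / (t \<bullet> b)) *\<^sub>R a"] tb by simp
      finally have s: "s = b + (\<Sum>a\<in>B - {b}. ((t \<bullet> a) / (t \<bullet> b)) *\<^sub>R a)" .
      moreover have "(\<Sum>a\<in>B - {b}. ((t \<bullet> a) / (t \<bullet> b)) *\<^sub>R a) \<in> Q b"
        unfolding Q_def using b(2) tb by (auto simp: abs_divide divide_le_eq)
      ultimately have "s \<in> (\<lambda>q. b + q) ` Q b" by blast
      moreover have "s \<noteq> 0" using tb t(3) by (simp add: s_def)
      moreover have "orth_proj V s = orth_proj V 0"
        unfolding s_def linear_scale[OF l] t(2) linear_0[OF l] by simp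
      ultimately show False using elim(2) b(1) by blast
    qed
  qed
qed

subsection \<open>Submanifold charts\<close>

lemma Cr_on_open_continuous_on: "Cr_on_open r S f \<Longrightarrow> continuous_on S f"
  unfolding Cr_on_open_def by (metis Cn_on.simps(1) i0_lb zero_enat_def)

lemma Cr_on_open_has_derivative:
  assumes "Cr_on_open r S f" "1 \<le> r" "x \<in> S"
  shows "(f has_derivative frechet_derivative f (at x)) (at x)"
proof -
  have "Cn_on (Suc 0) S f"
    using assms(1,2) unfolding Cr_on_open_def by (metis One_nat_def one_enat_def)
  then show ?thesis using Cn_on_has_derivative assms(3) by blast
qed

lemma Cr_on_open_if_Cr_map:
  assumes "open S" "Cr_map r S f"
  shows "Cr_on_open r S f"
  unfolding Cr_on_open_def
proof (intro allI impI, rule Cn_on_local)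
  fix n x assume n: "enat n \<le> r" and "x \<in> S"
  then obtain W g where W: "open W" "x \<in> W" "Cr_on_open r W g" "\<forall>y\<in>S \<inter> W. g y = f y"
    using assms(2) unfolding Cr_map_def by blast
  have "Cn_on n (S \<inter> W) g"
    by (rule Cn_on_subset[of n W]) (use W(3) n in \<open>auto simp: Cr_on_open_def\<close>)
  then have "Cn_on n (S \<inter> W) f"
    by (rule Cn_on_cong[OF open_Int[OF assms(1) W(1)], rotated]) (use W(4) in auto)
  then show "\<exists>W. open W \<and> x \<in> W \<and> Cn_on n W f"
    using W(1,2) assms(1) \<open>x \<in> S\<close> by blast
qed

lemma Cr_map_if_Cr_on_open:
  "open W \<Longrightarrow> S \<subseteq> W \<Longrightarrow> Cr_on_open r W f \<Longrightarrow> Cr_map r S f"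
  unfolding Cr_map_def by blast

text \<open>A slice chart of \<open>M\<close> at the fixed point \<open>x\<close>. The tangent space
  at \<open>x\<close> is represented as the image of \<open>E\<close> under
  \<open>A\<close>.\<close>

locale submanifold_chart =
  fixes r :: enat and m :: nat and M W W' E :: "(real^'n) set"
    and \<phi> \<psi> A :: "real^'n \<Rightarrow> real^'n" and x :: "real^'n"
  assumes r: "1 \<le> r"
    and open_W: "open W" and open_W': "open W'"
    and hom: "homeomorphism W W' \<phi> \<psi>"
    and Cr_\<phi>: "Cr_on_open r W \<phi>" and Cr_\<psi>: "Cr_on_open r W' \<psi>"
    and subspace_E: "subspace E" and dim_E: "dim E = m"
    and flatten: "\<phi> ` (M \<inter> W) = E \<inter> W'"
    and x: "x \<in> M" "x \<in> W"
    and A: "(\<psi> has_derivative A) (at (\<phi> x))"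
begin

lemma \<psi>_\<phi>: "y \<in> W \<Longrightarrow> \<psi> (\<phi> y) = y"
  and \<phi>_\<psi>: "z \<in> W' \<Longrightarrow> \<phi> (\<psi> z) = z"
  and \<phi>_in: "y \<in> W \<Longrightarrow> \<phi> y \<in> W'"
  and \<psi>_in: "z \<in> W' \<Longrightarrow> \<psi> z \<in> W"
  using hom by (auto simp: homeomorphism_def)

lemma \<phi>_in_E: "y \<in> M \<Longrightarrow> y \<in> W \<Longrightarrow> \<phi> y \<in> E"
  using flatten by auto

lemma \<psi>_in_M: "z \<in> E \<Longrightarrow> z \<in> W' \<Longrightarrow> \<psi> z \<in> M"
proof -
  assume "z \<in> E" "z \<in> W'"
  then obtain y where "y \<in> M" "y \<in> W" "z = \<phi> y" using flatten by blast
  then show "\<psi> z \<in> M" using \<psi>_\<phi> by simp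
qed

lemma linear_A: "linear A"
  using A by (rule has_derivative_linear)

text \<open>The chain rule applied to \<open>\<phi> (\<psi> z) = z\<close> gives \<open>A\<close> a
  left inverse.\<close>

lemma inj_A: "inj A"
proof -
  obtain B where B: "(\<phi> has_derivative B) (at x)"
    using Cr_on_open_has_derivative[OF Cr_\<phi> r x(2)] by blast
  have "((\<lambda>z. \<phi> (\<psi> z)) has_derivative (\<lambda>v. B (A v))) (at (\<phi> x))"
    using has_derivative_compose[OF A, of \<phi> B] B \<psi>_\<phi>[OF x(2)] by simp
  then have "((\<lambda>z. z) has_derivative (\<lambda>v. B (A v))) (at (\<phi> x))"
    by (rule has_derivative_transform_within_open[OF _ open_W' \<phi>_in[OF x(2)]]) (rule \<phi>_\<psi>)
  then have "(\<lambda>v. B (A v)) = (\<lambda>v. v)"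
    using has_derivative_unique has_derivative_ident by blast
  then show ?thesis by (metis injI)
qed

lemma subspace_tangent: "subspace (A ` E)"
  using linear_A subspace_E by (rule linear_subspace_image)

lemma dim_tangent: "dim (A ` E) = m"
  using dim_image_eq[OF linear_A inj_on_subset[OF inj_A], of E] dim_E by simp

lemma derivative_estimate:
  assumes "e > 0"
  obtains d where "d > 0" "\<And>z. norm (z - \<phi> x) < d \<Longrightarrow> norm (\<psi> z - x - A (z - \<phi> x)) \<le> e * norm (z - \<phi> x)"
  using A assms \<psi>_\<phi>[OF x(2)] unfolding has_derivative_at_alt by metis

text \<open>One endpoint is always \<open>x\<close>, so differentiability of \<open>\<psi>\<close>
  at the single point \<open>\<phi> x\<close> suffices. Being linear and injective, the projected
  derivative is bounded below by some \<open>c > 0\<close> on \<open>E\<close>; near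
  \<open>x\<close> the linearisation error is at most \<open>c / 2\<close> times the chart
  displacement, so half of that bound survives.\<close>

lemma local_bi_lipschitz:
  assumes V: "subspace V" and inj: "\<And>t. t \<in> A ` E \<Longrightarrow> orth_proj V t = 0 \<Longrightarrow> t = 0"
  obtains C \<delta> where "C \<ge> 0" "\<delta> > 0"
    "\<And>y. y \<in> M \<Longrightarrow> norm (y - x) < \<delta> \<Longrightarrow> norm (x - y) \<le> C * norm (orth_proj V x - orth_proj V y)"
proof -
  let ?P = "orth_proj V"
  note lP = linear_orth_proj[OF V]
  have lPA: "linear (\<lambda>e. ?P (A e))"
    using linear_compose[OF linear_A lP] by (simp add: comp_def)
  have "\<exists>c>0. \<forall>e\<in>E. c * norm e \<le> norm (?P (A e))"
  proof (rule injective_imp_isometric[OF closed_subspace[OF subspace_E] subspace_E])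
    show "bounded_linear (\<lambda>e. ?P (A e))" using lPA by (simp add: linear_conv_bounded_linear)
    show "\<forall>e\<in>E. ?P (A e) = 0 \<longrightarrow> e = 0"
    proof (intro ballI impI)
      fix e assume "e \<in> E" "?P (A e) = 0"
      then have "A e = A 0" using inj linear_0[OF linear_A] by simp
      then show "e = 0" using inj_A by (rule injD[rotated])
    qed
  qed
  then obtain c where c: "c > 0" "\<And>e. e \<in> E \<Longrightarrow> c * norm e \<le> norm (?P (A e))" by blast
  obtain K where K: "K > 0" "\<And>v. norm (A v) \<le> K * norm v"
    using linear_bounded_pos[OF linear_A] by blast
  obtain d where d: "d > 0" "\<And>z. norm (z - \<phi> x) < d \<Longrightarrow>
      norm (\<psi> z - x - A (z - \<phi> x)) \<le> c / 2 * norm (z - \<phi> x)"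
    using derivative_estimate[of "c / 2"] c(1) by auto
  have "isCont \<phi> x"
    using Cr_on_open_continuous_on[OF Cr_\<phi>] open_W x(2) by (simp add: continuous_on_eq_continuous_at)
  then obtain \<delta>1 where \<delta>1: "\<delta>1 > 0" "\<And>y. norm (y - x) < \<delta>1 \<Longrightarrow> norm (\<phi> y - \<phi> x) < d"
    using d(1) unfolding continuous_at_eps_delta dist_norm by metis
  obtain \<delta>2 where \<delta>2: "\<delta>2 > 0" "ball x \<delta>2 \<subseteq> W"
    using open_W x(2) open_contains_ball by blast
  \<comment> \<open>For a chart displacement \<open>v\<close>, the point moves by at most
    \<open>(K + c / 2) * norm v\<close> and its projection by at least
    \<open>c / 2 * norm v\<close>.\<close>
  define C where "C = (K + c / 2) / (c / 2)"
  have "norm (x - y) \<le> C * norm (?P x - ?P y)" if y: "y \<in> M" "norm (y - x) < min \<delta>1 \<delta>2" for y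
  proof -
    have yW: "y \<in> W" using y \<delta>2(2) by (auto simp: dist_norm norm_minus_commute)
    define v where "v = \<phi> y - \<phi> x"
    define w where "w = y - x - A v"
    have vE: "v \<in> E"
      unfolding v_def using \<phi>_in_E y(1) yW x subspace_E by (blast intro: subspace_diff)
    have w: "norm w \<le> c / 2 * norm v"
      using d(2)[OF \<delta>1(2)[of y]] y(2) unfolding v_def w_def \<psi>_\<phi>[OF yW] by simp
    have yx: "y - x = A v + w" by (simp add: w_def)
    have "?P y - ?P x = ?P (A v) + ?P w"
      unfolding linear_diff[OF lP, symmetric] yx by (rule linear_add[OF lP])
    then have "norm (?P (A v)) \<le> norm (?P y - ?P x) + norm (?P w)"
      using norm_triangle_ineq4[of "?P y - ?P x" "?P w"] by simp
    then have "c * norm v \<le> norm (?P y - ?P x) + c / 2 * norm v"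
      using c(2)[OF vE] norm_orth_proj_le(1)[OF V, of w] w by linarith
    then have 1: "c / 2 * norm v \<le> norm (?P y - ?P x)" by simp
    have "norm (y - x) \<le> (K + c / 2) * norm v"
      using norm_triangle_ineq[of "A v" w] K(2)[of v] w unfolding yx by (simp add: distrib_right)
    also have "\<dots> = C * (c / 2 * norm v)" using c(1) by (simp add: C_def)
    also have "\<dots> \<le> C * norm (?P y - ?P x)"
      using 1 c(1) K(1) by (intro mult_left_mono) (auto simp: C_def)
    finally show ?thesis by (simp add: norm_minus_commute)
  qed
  moreover have "C \<ge> 0" using c(1) K(1) by (simp add: C_def)
  ultimately show ?thesis using that[of C "min \<delta>1 \<delta>2"] \<delta>1(1) \<delta>2(1) by simp
qed

text \<open>Away from \<open>x\<close> the remaining part of \<open>X\<close> is compact and avoids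
  the fibre of \<open>x\<close>, so the projected distance has a positive minimum \<open>c\<close>
  there. With \<open>D\<close> bounding the distances from \<open>x\<close>, the constant
  \<open>D / c\<close> works on that part.\<close>

lemma bi_lipschitz_at:
  assumes V: "subspace V" and inj: "\<And>t. t \<in> A ` E \<Longrightarrow> orth_proj V t = 0 \<Longrightarrow> t = 0"
    and X: "compact X" "X \<subseteq> M" and inj_x: "\<And>y. y \<in> X \<Longrightarrow> y \<noteq> x \<Longrightarrow> orth_proj V y \<noteq> orth_proj V x"
  shows "\<exists>C\<ge>0. \<forall>y\<in>X. norm (x - y) \<le> C * norm (orth_proj V x - orth_proj V y)"
proof -
  let ?P = "orth_proj V"
  obtain C \<delta> where C: "C \<ge> 0" "\<delta> > 0"
    "\<And>y. y \<in> M \<Longrightarrow> norm (y - x) < \<delta> \<Longrightarrow> norm (x - y) \<le> C * norm (?P x - ?P y)"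
    using local_bi_lipschitz[OF V inj] by blast
  let ?Y = "X - ball x \<delta>"
  have cP: "continuous_on S ?P" for S
    using linear_orth_proj[OF V] linear_continuous_on linear_conv_bounded_linear by blast
  have cY: "compact ?Y" using X(1) by (intro compact_diff) auto
  show ?thesis
  proof (cases "?Y = {}")
    case True
    have "norm (x - y) \<le> C * norm (?P x - ?P y)" if "y \<in> X" for y
    proof (rule C(3))
      show "y \<in> M" using that X(2) by blast
      show "norm (y - x) < \<delta>" using that True by (auto simp: dist_norm norm_minus_commute)
    qed
    then show ?thesis using C(1) by blast
  next
    case False
    have "continuous_on ?Y (\<lambda>y. norm (?P x - ?P y))"
      by (intro continuous_intros cP)
    from continuous_attains_inf[OF cY False this]
    obtain y0 where y0: "y0 \<in> ?Y" "\<And>y. y \<in> ?Y \<Longrightarrow> norm (?P x - ?P y0) \<le> norm (?P x - ?P y)"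
      by blast
    define c where "c = norm (?P x - ?P y0)"
    have "y0 \<noteq> x" using y0(1) C(2) by auto
    then have c: "c > 0" using y0(1) inj_x[of y0] by (auto simp: c_def)
    obtain D where D: "D > 0" "\<And>y. y \<in> X \<Longrightarrow> norm (x - y) \<le> D"
    proof -
      obtain e where "\<And>y. y \<in> X \<Longrightarrow> dist x y \<le> e"
        using compact_imp_bounded[OF X(1)] unfolding bounded_any_center[where a = x] by blast
      then show ?thesis using that[of "max 1 e"] by (force simp: dist_norm)
    qed
    have "norm (x - y) \<le> max C (D / c) * norm (?P x - ?P y)" if y: "y \<in> X" for y
    proof (cases "norm (y - x) < \<delta>")
      case True
      have "C * norm (?P x - ?P y) \<le> max C (D / c) * norm (?P x - ?P y)"
        by (rule mult_right_mono) auto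
      then show ?thesis using C(3)[of y] y X(2) True by force
    next
      case False
      then have "y \<in> ?Y" using y by (simp add: dist_norm norm_minus_commute)
      then have "c \<le> norm (?P x - ?P y)" using y0(2) by (simp add: c_def)
      then have "D / c * c \<le> D / c * norm (?P x - ?P y)"
        using D(1) c by (intro mult_left_mono) auto
      then have "D \<le> D / c * norm (?P x - ?P y)" using c by simp
      also have "\<dots> \<le> max C (D / c) * norm (?P x - ?P y)"
        by (rule mult_right_mono) auto
      finally show ?thesis using D(2)[OF y] by simp
    qed
    then show ?thesis using C(1) by (intro exI[of _ "max C (D / c)"]) auto
  qed
qed

text \<open>Along a curve in \<open>M\<close> leaving \<open>x\<close> in direction
  \<open>t\<close>, the point moves linearly in \<open>s\<close>. If \<open>t\<close> were projected
  to zero, the projection would move only by the linearisation error, which is of smaller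
  order.\<close>

lemma inj_tangent_if_bi_lipschitz:
  assumes V: "subspace V" and C: "C \<ge> 0" "\<And>y. y \<in> M \<Longrightarrow> norm (x - y) \<le> C * norm (orth_proj V x - orth_proj V y)"
    and t: "t \<in> A ` E" "orth_proj V t = 0"
  shows "t = 0"
proof (rule ccontr)
  assume t0: "t \<noteq> 0"
  let ?P = "orth_proj V"
  note lP = linear_orth_proj[OF V]
  obtain e where e: "e \<in> E" "t = A e" using t(1) by blast
  have e0: "norm e > 0" using e t0 linear_0[OF linear_A] by auto
  \<comment> \<open>With \<open>w\<close> the linearisation error, the bound yields
    \<open>norm (s *\<^sub>R t) \<le> (C + 1) * norm w\<close>; \<open>\<epsilon>\<close> is chosen
    to make the right-hand side at most half of \<open>s * norm t\<close>.\<close>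
  define K where "K = C + 1"
  have K: "K > 0" using C(1) by (simp add: K_def)
  define \<epsilon> where "\<epsilon> = norm t / (2 * K * norm e)"
  have \<epsilon>: "\<epsilon> > 0" using t0 e0 K by (simp add: \<epsilon>_def)
  obtain d where d: "d > 0" "\<And>z. norm (z - \<phi> x) < d \<Longrightarrow> norm (\<psi> z - x - A (z - \<phi> x)) \<le> \<epsilon> * norm (z - \<phi> x)"
    using derivative_estimate[OF \<epsilon>] by blast
  obtain \<eta> where \<eta>: "\<eta> > 0" "ball (\<phi> x) \<eta> \<subseteq> W'"
    using open_W' \<phi>_in[OF x(2)] open_contains_ball by blast
  define s where "s = min d \<eta> / (2 * norm e)"
  have s: "s > 0" using d(1) \<eta>(1) e0 by (simp add: s_def)
  have "norm (s *\<^sub>R e) = s * norm e" using s by simp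
  also have "\<dots> = min d \<eta> / 2" using e0 by (simp add: s_def)
  finally have se: "norm (s *\<^sub>R e) < d" "norm (s *\<^sub>R e) < \<eta>"
    using d(1) \<eta>(1) by linarith+
  define z where "z = \<phi> x + s *\<^sub>R e"
  have zW: "z \<in> W'" using \<eta>(2) se(2) by (auto simp: z_def dist_norm)
  have zE: "z \<in> E"
    unfolding z_def using \<phi>_in_E x e(1) subspace_E by (blast intro: subspace_add subspace_scale)
  define w where "w = \<psi> z - x - s *\<^sub>R t"
  have w: "norm w \<le> \<epsilon> * (s * norm e)"
    using d(2)[of z] se(1) s unfolding w_def z_def e(2) by (simp add: linear_scale[OF linear_A])
  have yx: "\<psi> z - x = s *\<^sub>R t + w" by (simp add: w_def)
  have "?P (\<psi> z) - ?P x = ?P w"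
    unfolding linear_diff[OF lP, symmetric] yx by (simp add: linear_add[OF lP] linear_scale[OF lP] t(2))
  then have "norm (?P x - ?P (\<psi> z)) \<le> norm w"
    using norm_orth_proj_le(1)[OF V, of w] norm_minus_commute[of "?P x" "?P (\<psi> z)"] by simp
  then have "C * norm (?P x - ?P (\<psi> z)) \<le> C * norm w"
    using C(1) by (rule mult_left_mono)
  then have 1: "norm (s *\<^sub>R t + w) \<le> C * norm w"
    using C(2)[OF \<psi>_in_M[OF zE zW]] by (simp add: norm_minus_commute flip: yx)
  have "norm (s *\<^sub>R t) \<le> norm (s *\<^sub>R t + w) + norm w"
    using norm_triangle_ineq4[of "s *\<^sub>R t + w" w] by simp
  also have "\<dots> \<le> K * norm w" using 1 by (simp add: K_def distrib_right)
  also have "\<dots> \<le> K * (\<epsilon> * (s * norm e))"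
    using w K by (intro mult_left_mono) auto
  also have "\<dots> = s * norm t / 2"
    using e0 K by (simp add: \<epsilon>_def)
  finally have "s * norm t \<le> s * norm t / 2" using s by simp
  then show False using mult_pos_pos[OF s, of "norm t"] t0 by simp
qed

end

lemma submanifold_chart_exists:
  fixes M :: "(real^'n) set"
  assumes "embedded_submanifold r m UNIV M" "1 \<le> r" "x \<in> M"
  obtains W W' E \<phi> \<psi> A where "submanifold_chart r m M W W' E \<phi> \<psi> A x"
proof -
  have "\<exists>W (W' :: (real^'n) set) \<phi> E. openin (top_of_set UNIV) W \<and> x \<in> W \<and> openin (top_of_set UNIV) W' \<and>
      Cr_diffeomorphism r W W' \<phi> \<and> subspace E \<and> E \<subseteq> UNIV \<and> dim E = m \<and> \<phi> ` (M \<inter> W) = E \<inter> W'"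
    using assms(1,3) unfolding embedded_submanifold_def by (elim conjE) (erule bspec)
  then obtain W and W' :: "(real^'n) set" and \<phi> E where W: "open W" "x \<in> W" "open W'" "Cr_diffeomorphism r W W' \<phi>"
    "subspace E" "dim E = m" "\<phi> ` (M \<inter> W) = E \<inter> W'"
    unfolding subtopology_UNIV open_openin[symmetric] by blast
  obtain \<psi> where \<psi>: "homeomorphism W W' \<phi> \<psi>" "Cr_map r W \<phi>" "Cr_map r W' \<psi>"
    using W(4) unfolding Cr_diffeomorphism_def by blast
  have C: "Cr_on_open r W \<phi>" "Cr_on_open r W' \<psi>"
    using Cr_on_open_if_Cr_map W(1,3) \<psi>(2,3) by blast+
  have "\<phi> x \<in> W'" using \<psi>(1) W(2) by (auto simp: homeomorphism_def)
  from Cr_on_open_has_derivative[OF C(2) assms(2) this]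
  have "submanifold_chart r m M W W' E \<phi> \<psi> (frechet_derivative \<psi> (at (\<phi> x))) x"
    using assms(2,3) W \<psi>(1) C by unfold_locales
  then show ?thesis using that by blast
qed

section \<open>Box counting for the manifold and charts of its projection\<close>

lemma Cr_on_open_lipschitz:
  fixes f :: "'a::euclidean_space \<Rightarrow> 'b::euclidean_space"
  assumes "Cr_on_open r S f" "1 \<le> r" "compact K" "convex K" "K \<subseteq> S"
  obtains L where "\<And>y z. y \<in> K \<Longrightarrow> z \<in> K \<Longrightarrow> norm (f y - f z) \<le> L * norm (y - z)"
proof -
  let ?f' = "\<lambda>x. frechet_derivative f (at x)"
  have C1: "Cn_on (Suc 0) S f"
    using assms(1,2) unfolding Cr_on_open_def by (metis One_nat_def one_enat_def)
  have "continuous_on K (\<lambda>x. \<Sum>i\<in>Basis. norm (?f' x i))"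
    using C1 assms(5) by (intro continuous_intros) (auto intro: continuous_on_subset)
  then have "bounded ((\<lambda>x. \<Sum>i\<in>Basis. norm (?f' x i)) ` K)"
    using assms(3) compact_continuous_image compact_imp_bounded by blast
  then obtain L where L: "\<And>x. x \<in> K \<Longrightarrow> norm (\<Sum>i\<in>Basis. norm (?f' x i)) \<le> L"
    unfolding bounded_iff by auto
  have der: "(f has_derivative ?f' x) (at x)" if "x \<in> K" for x
    using Cn_on_has_derivative[OF C1] assms(5) that by blast
  have "onorm (?f' x) \<le> L" if x: "x \<in> K" for x
  proof (rule onorm_le)
    fix v
    have lin: "linear (?f' x)" using der[OF x] by (rule has_derivative_linear)
    have eq: "?f' x v = (\<Sum>i\<in>Basis. (v \<bullet> i) *\<^sub>R ?f' x i)"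
      by (subst euclidean_representation[of v, symmetric])
         (simp add: linear_sum[OF lin] linear_scale[OF lin] del: euclidean_representation)
    have "norm (?f' x v) \<le> (\<Sum>i\<in>Basis. norm ((v \<bullet> i) *\<^sub>R ?f' x i))"
      unfolding eq by (rule norm_sum)
    also have "\<dots> \<le> (\<Sum>i\<in>Basis. norm (?f' x i) * norm v)"
    proof (rule sum_mono)
      fix i :: 'a assume "i \<in> Basis"
      then have "\<bar>v \<bullet> i\<bar> * norm (?f' x i) \<le> norm v * norm (?f' x i)"
        by (intro mult_right_mono Basis_le_norm) auto
      then show "norm ((v \<bullet> i) *\<^sub>R ?f' x i) \<le> norm (?f' x i) * norm v"
        by (simp add: mult.commute)
    qed
    also have "\<dots> = (\<Sum>i\<in>Basis. norm (?f' x i)) * norm v"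
      by (simp add: sum_distrib_right)
    also have "\<dots> \<le> L * norm v"
      using L[OF x] by (intro mult_right_mono) auto
    finally show "norm (?f' x v) \<le> L * norm v" .
  qed
  then have "norm (f y - f z) \<le> L * norm (y - z)" if "y \<in> K" "z \<in> K" for y z
    using differentiable_bound[OF assms(4) has_derivative_at_withinI[OF der], of L] that by blast
  then show ?thesis using that by blast
qed

context submanifold_chart
begin

text \<open>Near \<open>x\<close>, \<open>M\<close> is a Lipschitz image under \<open>\<psi>\<close>
  of part of a scaled cube in \<open>E\<close>, so it inherits the counting exponent
  \<open>dim E\<close>.\<close>

lemma box_cover_local:
  obtains N where "open N" "x \<in> N" "box_cover m (M \<inter> N)"
proof -
  let ?p = "\<phi> x"
  obtain \<eta> where \<eta>: "\<eta> > 0" "cball ?p \<eta> \<subseteq> W'"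
    using open_W' \<phi>_in[OF x(2)] open_contains_cball by blast
  obtain L where L: "\<And>y z. y \<in> cball ?p \<eta> \<Longrightarrow> z \<in> cball ?p \<eta> \<Longrightarrow> norm (\<psi> y - \<psi> z) \<le> L * norm (y - z)"
    using Cr_on_open_lipschitz[OF Cr_\<psi> r compact_cball convex_cball \<eta>(2)] by blast
  obtain B where B: "B \<subseteq> E" "pairwise orthogonal B" "\<And>b. b \<in> B \<Longrightarrow> norm b = 1"
      "independent B" "card B = dim E" "span B = E"
    using orthonormal_basis_subspace[OF subspace_E] by blast
  have finB: "finite B" using B(4) independent_imp_finite by blast
  let ?Q = "{\<Sum>b\<in>B. c b *\<^sub>R b | c. \<forall>b\<in>B. \<bar>c b\<bar> \<le> 1}"
  have "box_cover m ?Q"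
    using box_cover_cube[OF finB] B(3,5) dim_E by simp
  then have "box_cover m ((\<lambda>q. ?p + \<eta> *\<^sub>R q) ` ?Q)"
    by (rule box_cover_lipschitz_image[of _ _ _ \<eta>]) (use \<eta>(1) in \<open>simp add: dist_norm flip: scaleR_diff_right\<close>)
  moreover have "E \<inter> cball ?p \<eta> \<subseteq> (\<lambda>q. ?p + \<eta> *\<^sub>R q) ` ?Q"
  proof
    fix z assume z: "z \<in> E \<inter> cball ?p \<eta>"
    define v where "v = (1 / \<eta>) *\<^sub>R (z - ?p)"
    have "z - ?p \<in> E"
      using z \<phi>_in_E x subspace_E by (blast intro: subspace_diff)
    then have vE: "v \<in> E" unfolding v_def using subspace_E by (blast intro: subspace_scale)
    have "norm v \<le> 1"
      using z \<eta>(1) by (simp add: v_def dist_norm norm_minus_commute)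
    then have "\<bar>v \<bullet> b\<bar> \<le> 1" if "b \<in> B" for b
      using Cauchy_Schwarz_ineq2[of v b] B(3)[OF that] by simp
    moreover have "(\<Sum>b\<in>B. (v \<bullet> b) *\<^sub>R b) = v"
      by (rule orthonormal_basis_expand[OF B(2,3) _ finB]) (use vE B(6) in auto)
    ultimately have "v \<in> ?Q" by (intro CollectI exI[of _ "\<lambda>b. v \<bullet> b"]) simp
    moreover have "z = ?p + \<eta> *\<^sub>R v" using \<eta>(1) by (simp add: v_def)
    ultimately show "z \<in> (\<lambda>q. ?p + \<eta> *\<^sub>R q) ` ?Q" by blast
  qed
  \<comment> \<open>The cube may stick out of the ball on which \<open>\<psi>\<close> is Lipschitz,
    so the cover is cut down before \<open>\<psi>\<close> is applied.\<close>
  ultimately have "box_cover m (E \<inter> cball ?p \<eta>)" by (rule box_cover_subset)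
  then have bc: "box_cover m (\<psi> ` (E \<inter> cball ?p \<eta>))"
    by (rule box_cover_lipschitz_image[of _ _ _ L]) (use L in \<open>auto simp: dist_norm\<close>)
  let ?N = "W \<inter> \<phi> -` ball ?p \<eta>"
  have "open ?N"
    using Cr_on_open_continuous_on[OF Cr_\<phi>] open_W by (intro continuous_open_preimage) auto
  moreover have "x \<in> ?N" using x(2) \<eta>(1) by simp
  moreover have "M \<inter> ?N \<subseteq> \<psi> ` (E \<inter> cball ?p \<eta>)"
  proof
    fix y assume y: "y \<in> M \<inter> ?N"
    then have "\<phi> y \<in> E \<inter> cball ?p \<eta>" using \<phi>_in_E by auto
    then show "y \<in> \<psi> ` (E \<inter> cball ?p \<eta>)" using \<psi>_\<phi>[of y] y by (metis IntD1 IntD2 image_eqI)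
  qed
  ultimately show ?thesis using that bc box_cover_subset by blast
qed

text \<open>\<open>h u = P (\<psi> (R (\<rho> u))) + u - \<rho> u\<close> extends the parametrization \<open>P \<circ> \<psi>\<close> of the projected
  manifold to an ambient map which has identity derivative at the base point and preserves \<open>V\<close>, so
  that its local inverse is a slice chart.\<close>

lemma projection_chart:
  assumes V: "subspace V" and M: "compact M"
    and C: "C \<ge> 0" "\<And>y. y \<in> M \<Longrightarrow> norm (x - y) \<le> C * norm (orth_proj V x - orth_proj V y)"
  shows "\<exists>U Q. openin (top_of_set M) U \<and> x \<in> U \<and>
          openin (top_of_set V) Q \<and> orth_proj V x \<in> Q \<and>
          embedded_submanifold r m V (Q \<inter> orth_proj V ` M) \<and>
          Cr_diffeomorphism r U (Q \<inter> orth_proj V ` M) (orth_proj V)"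
proof -
  define P where "P = orth_proj V"
  have lP: "linear P" unfolding P_def by (rule linear_orth_proj[OF V])
  have blP: "bounded_linear P" using lP by (simp add: linear_conv_bounded_linear)
  have P_in: "P y \<in> V" for y unfolding P_def by (rule orth_proj_in[OF V])
  have cP: "continuous_on S P" for S
    using lP linear_continuous_on linear_conv_bounded_linear by blast
  define L where "L = (\<lambda>e. P (A e))"
  have lL: "linear L" unfolding L_def using linear_compose[OF linear_A lP] by (simp add: comp_def)
  have L0: "e = 0" if "e \<in> E" "L e = 0" for e
  proof -
    have "A e = 0"
      using inj_tangent_if_bi_lipschitz[OF V C] that by (auto simp: L_def P_def)
    then have "A e = A 0" using linear_0[OF linear_A] by simp
    then show ?thesis using inj_A by (rule injD[rotated])
  qed
  have injL: "inj_on L E"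
    unfolding linear_inj_on_iff_eq_0[OF lL subspace_E] using L0 by blast
  define E' where "E' = L ` E"
  have sE': "subspace E'" unfolding E'_def using lL subspace_E by (rule linear_subspace_image)
  have E'V: "E' \<subseteq> V" unfolding E'_def L_def using P_in by blast
  have dE': "dim E' = m"
    unfolding E'_def using dim_image_eq[OF lL, of E] injL subspace_E dim_E by (simp add: span_eq_iff[THEN iffD2])
  obtain R where R: "range R \<subseteq> E" "linear R" "\<And>e. e \<in> E \<Longrightarrow> R (L e) = e"
    using linear_exists_left_inverse_on[OF lL subspace_E injL] by auto
  define \<rho> where "\<rho> = orth_proj E'"
  have l\<rho>: "linear \<rho>" unfolding \<rho>_def by (rule linear_orth_proj[OF sE'])
  have \<rho>_in: "\<rho> u \<in> E'" for u unfolding \<rho>_def by (rule orth_proj_in[OF sE'])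
  have \<rho>_id: "\<rho> u = u" if "u \<in> E'" for u unfolding \<rho>_def by (rule orth_proj_id[OF sE' that])
  define R\<rho> where "R\<rho> = (\<lambda>u. R (\<rho> u))"
  have lR\<rho>: "linear R\<rho>" unfolding R\<rho>_def using linear_compose[OF l\<rho> R(2)] by (simp add: comp_def)
  have blR\<rho>: "bounded_linear R\<rho>" using lR\<rho> by (simp add: linear_conv_bounded_linear)
  have R\<rho>_in: "R\<rho> u \<in> E" for u unfolding R\<rho>_def using R(1) by blast
  have R\<rho>_L: "R\<rho> (L e) = e" if "e \<in> E" for e
    unfolding R\<rho>_def using \<rho>_id[of "L e"] R(3)[OF that] that by (simp add: E'_def)
  have L_R\<rho>: "L (R\<rho> u) = \<rho> u" for u
    using \<rho>_in[of u] R(3) unfolding R\<rho>_def E'_def by auto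
  have cR\<rho>: "continuous_on S R\<rho>" for S
    using lR\<rho> linear_continuous_on linear_conv_bounded_linear by blast
  have cL: "continuous_on S L" for S
    using lL linear_continuous_on linear_conv_bounded_linear by blast
  define p where "p = \<phi> x"
  have p: "p \<in> E" "p \<in> W'" "\<psi> p = x"
    unfolding p_def using \<phi>_in_E \<phi>_in \<psi>_\<phi> x by auto
  define U0 where "U0 = R\<rho> -` W'"
  have U0: "open U0"
    unfolding U0_def using open_W' cR\<rho> by (rule open_vimage)
  have u0: "L p \<in> U0" unfolding U0_def using R\<rho>_L[OF p(1)] p(2) by simp
  define h where "h = (\<lambda>u. P (\<psi> (R\<rho> u)) + u - \<rho> u)"
  have Cr_h: "Cr_on_open r U0 h"
    unfolding Cr_on_open_def
  proof (intro allI impI)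
    fix n assume "enat n \<le> r"
    then have "Cn_on n W' \<psi>" using Cr_\<psi> by (simp add: Cr_on_open_def)
    then have "Cn_on n U0 (\<lambda>u. \<psi> (R\<rho> u))"
      by (intro Cn_on_compose[OF U0 open_W' _ Cn_on_linear[OF U0 lR\<rho>]]) (auto simp: U0_def)
    then have "Cn_on n U0 (\<lambda>u. P (\<psi> (R\<rho> u)))"
      by (rule Cn_on_bounded_linear[OF U0 blP])
    then show "Cn_on n U0 h"
      unfolding h_def by (intro Cn_on_diff Cn_on_add Cn_on_id Cn_on_linear[OF _ l\<rho>] U0)
  qed
  have "(h has_derivative (\<lambda>v. P (A (R\<rho> v)) + v - \<rho> v)) (at (L p))"
  proof -
    have "(R\<rho> has_derivative R\<rho>) (at (L p))" "(\<rho> has_derivative \<rho>) (at (L p))"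
      using lR\<rho> l\<rho> by (auto intro: linear_imp_has_derivative)
    moreover have "(\<psi> has_derivative A) (at (R\<rho> (L p)))"
      unfolding R\<rho>_L[OF p(1)] unfolding p_def by (rule A)
    ultimately have "((\<lambda>u. \<psi> (R\<rho> u)) has_derivative (\<lambda>v. A (R\<rho> v))) (at (L p))"
      using has_derivative_compose by blast
    then have "((\<lambda>u. P (\<psi> (R\<rho> u))) has_derivative (\<lambda>v. P (A (R\<rho> v)))) (at (L p))"
      by (rule bounded_linear.has_derivative[OF blP])
    then show ?thesis
      unfolding h_def using \<open>(\<rho> has_derivative \<rho>) (at (L p))\<close>
      by (intro has_derivative_diff has_derivative_add has_derivative_ident)
  qed
  \<comment> \<open>Here \<open>P (A (R\<rho> v)) = L (R\<rho> v) = \<rho> v\<close>, which cancels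
    the subtracted \<open>\<rho> v\<close>.\<close>
  then have "(h has_derivative (\<lambda>v. v)) (at (L p))"
    using L_R\<rho> by (simp add: L_def)
  from Cr_inverse_function[OF r U0 u0 Cr_h this]
  obtain U' V' g where g: "open U'" "U' \<subseteq> U0" "L p \<in> U'" "open V'" "homeomorphism U' V' h g"
    "Cr_on_open r V' g"
    by blast
  have g_h: "g (h u) = u" "h u \<in> V'" if "u \<in> U'" for u
    using g(5) that by (auto simp: homeomorphism_def)
  have h_g: "h (g z) = z" "g z \<in> U'" if "z \<in> V'" for z
    using g(5) that by (auto simp: homeomorphism_def)
  have h_V: "h u \<in> V \<longleftrightarrow> u \<in> V" for u
  proof -
    have "h u - u \<in> V"
      unfolding h_def using subspace_diff[OF V P_in subsetD[OF E'V \<rho>_in]] by simp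
    then show ?thesis
      using subspace_add[OF V, of "h u - u" u] subspace_diff[OF V, of "h u" "h u - u"] by auto
  qed
  have h_E': "h u = P (\<psi> (R\<rho> u))" if "u \<in> E'" for u
    using \<rho>_id[OF that] by (simp add: h_def)
  have h_L: "h (L (\<phi> y)) = P y" "L (\<phi> y) \<in> E'" if "y \<in> M" "y \<in> W" for y
    using h_E'[of "L (\<phi> y)"] R\<rho>_L[OF \<phi>_in_E[OF that]] \<psi>_\<phi>[OF that(2)] \<phi>_in_E[OF that] by (auto simp: E'_def)
  define N where "N = W \<inter> (\<lambda>y. L (\<phi> y)) -` U'"
  have N: "open N"
    unfolding N_def using open_W g(1) Cr_on_open_continuous_on[OF Cr_\<phi>] cL
    by (intro continuous_open_preimage continuous_on_compose2[OF cL[of UNIV]]) auto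
  have xN: "x \<in> N" using x(2) g(3) by (simp add: N_def p_def)
  \<comment> \<open>Deleting the projection of \<open>M - N\<close> forces every point of
    \<open>M\<close> above \<open>Z\<close> into \<open>N\<close>. Compactness keeps
    \<open>Z\<close> open, and the bound keeps \<open>P x\<close> in \<open>Z\<close>: equal
    projections would give \<open>y = x\<close>, a point of \<open>N\<close>.\<close>
  define Z where "Z = V' - P ` (M - N)"
  have Z: "open Z"
  proof -
    have "compact (P ` (M - N))"
      using M N by (intro compact_continuous_image cP compact_diff)
    then show ?thesis unfolding Z_def using g(4) compact_imp_closed open_Diff by blast
  qed
  have ZV': "Z \<subseteq> V'" by (auto simp: Z_def)
  have PxZ: "P x \<in> Z"
  proof -
    have "P x \<in> V'"
      using g_h(2)[OF g(3)] h_L(1)[OF x] by (simp add: p_def)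
    moreover have "P x \<noteq> P y" if "y \<in> M - N" for y
      using C(2)[of y] that xN by (auto simp: P_def)
    ultimately show ?thesis by (auto simp: Z_def)
  qed
  define U where "U = M \<inter> P -` Z"
  define Q where "Q = V \<inter> Z"
  define S where "S = Q \<inter> P ` M"
  have UN: "y \<in> N" if "y \<in> U" for y using that by (auto simp: U_def Z_def)
  have S_eq: "S = P ` U" using P_in by (auto simp: S_def Q_def U_def)
  \<comment> \<open>The inverse of the projection on \<open>U\<close>, written so that it is defined
    and smooth on the ambient open set \<open>V'\<close>.\<close>
  define k where "k = (\<lambda>z. \<psi> (R\<rho> (g z)))"
  have g_P: "g (P y) = L (\<phi> y)" "P y \<in> V'" if "y \<in> U" for y
  proof -
    have "y \<in> M" "y \<in> W" "L (\<phi> y) \<in> U'" using UN[OF that] that by (auto simp: N_def U_def)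
    then show "g (P y) = L (\<phi> y)" "P y \<in> V'" using g_h[of "L (\<phi> y)"] h_L(1) by auto
  qed
  have k_P: "k (P y) = y" if "y \<in> U" for y
  proof -
    have "y \<in> M" "y \<in> W" using UN[OF that] that by (auto simp: N_def U_def)
    then show ?thesis
      unfolding k_def g_P(1)[OF that] using R\<rho>_L \<phi>_in_E \<psi>_\<phi> by simp
  qed
  have Cr_k: "Cr_on_open r V' k"
    unfolding Cr_on_open_def
  proof (intro allI impI)
    fix n assume "enat n \<le> r"
    then have "Cn_on n W' \<psi>" "Cn_on n V' g" using Cr_\<psi> g(6) by (auto simp: Cr_on_open_def)
    then have 1: "Cn_on n W' \<psi>" and 2: "Cn_on n V' (\<lambda>z. R\<rho> (g z))"
      by (simp_all add: Cn_on_bounded_linear[OF g(4) blR\<rho>])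
    have 3: "(\<lambda>z. R\<rho> (g z)) ` V' \<subseteq> W'"
      using h_g(2) g(2) by (auto simp: U0_def)
    show "Cn_on n V' k"
      unfolding k_def by (rule Cn_on_compose[OF g(4) open_W' 3 2 1])
  qed
  have SV': "S \<subseteq> V'" using ZV' by (auto simp: S_def Q_def)
  have diffeo: "Cr_diffeomorphism r U S P"
    unfolding Cr_diffeomorphism_def
  proof (intro exI[of _ k] conjI)
    show "homeomorphism U S P k"
    proof (rule homeomorphismI)
      show "continuous_on S k"
        using Cr_on_open_continuous_on[OF Cr_k] SV' by (rule continuous_on_subset)
    qed (use cP S_eq k_P in auto)
    show "Cr_map r U P"
      using Cn_on_linear[OF open_UNIV lP] by (intro Cr_map_if_Cr_on_open[of UNIV]) (auto simp: Cr_on_open_def)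
    show "Cr_map r S k"
      by (rule Cr_map_if_Cr_on_open[OF g(4) SV' Cr_k])
  qed
  \<comment> \<open>As \<open>h\<close> preserves and reflects membership in \<open>V\<close>, its
    inverse \<open>g\<close> carries \<open>Q\<close> onto \<open>V \<inter> Y\<close>.\<close>
  define Y where "Y = {u \<in> U'. h u \<in> Z}"
  have Y: "open Y"
  proof -
    have "open (U' \<inter> h -` Z)"
      using g(1,5) Z by (intro continuous_open_preimage) (auto simp: homeomorphism_def)
    then show ?thesis by (simp add: Y_def vimage_def Int_def)
  qed
  have slice: "Cr_diffeomorphism r Q (V \<inter> Y) g"
    unfolding Cr_diffeomorphism_def
  proof (intro exI[of _ h] conjI)
    show "homeomorphism Q (V \<inter> Y) g h"
    proof (rule homeomorphismI)
      show "continuous_on Q g"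
        using Cr_on_open_continuous_on[OF g(6)] by (rule continuous_on_subset) (use ZV' in \<open>auto simp: Q_def\<close>)
      show "continuous_on (V \<inter> Y) h"
        using Cr_on_open_continuous_on[OF Cr_h] by (rule continuous_on_subset) (use g(2) in \<open>auto simp: Y_def\<close>)
      show "g ` Q \<subseteq> V \<inter> Y"
      proof
        fix u assume "u \<in> g ` Q"
        then obtain z where z: "z \<in> V" "z \<in> Z" "u = g z" by (auto simp: Q_def)
        then have "h u = z" "u \<in> U'" using h_g ZV' by auto
        then show "u \<in> V \<inter> Y" using h_V[of u] z by (simp add: Y_def)
      qed
      show "h ` (V \<inter> Y) \<subseteq> Q" using h_V by (auto simp: Q_def Y_def)
      show "h (g z) = z" if "z \<in> Q" for z using h_g(1) that ZV' by (auto simp: Q_def)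
      show "g (h u) = u" if "u \<in> V \<inter> Y" for u using g_h(1) that by (auto simp: Y_def)
    qed
    show "Cr_map r Q g"
      by (rule Cr_map_if_Cr_on_open[OF g(4) _ g(6)]) (use ZV' in \<open>auto simp: Q_def\<close>)
    show "Cr_map r (V \<inter> Y) h"
      by (rule Cr_map_if_Cr_on_open[OF U0 _ Cr_h]) (use g(2) in \<open>auto simp: Y_def\<close>)
  qed
  \<comment> \<open>On \<open>E'\<close> the correction \<open>u - \<rho> u\<close> vanishes, so
    \<open>h u\<close> is the projection of a point of \<open>M\<close>. Conversely,
    \<open>g\<close> sends the projection of \<open>y\<close> in \<open>U\<close> to
    \<open>L (\<phi> y)\<close>, which lies in \<open>E'\<close>.\<close>
  have flat: "g ` (S \<inter> Q) = E' \<inter> (V \<inter> Y)"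
  proof (intro equalityI subsetI)
    fix u assume "u \<in> g ` (S \<inter> Q)"
    then obtain y where y: "y \<in> U" "u = g (P y)" using S_eq by auto
    then have "y \<in> M" "y \<in> W" "u = L (\<phi> y)" "u \<in> U'" "P y \<in> Z"
      using UN[OF y(1)] g_P(1)[OF y(1)] by (auto simp: N_def U_def)
    then show "u \<in> E' \<inter> (V \<inter> Y)" using h_L E'V by (auto simp: Y_def)
  next
    fix u assume u: "u \<in> E' \<inter> (V \<inter> Y)"
    then have uU: "u \<in> U'" "h u \<in> Z" by (auto simp: Y_def)
    have RW: "R\<rho> u \<in> W'" using uU(1) g(2) by (auto simp: U0_def)
    define y where "y = \<psi> (R\<rho> u)"
    have "y \<in> M" unfolding y_def by (rule \<psi>_in_M[OF R\<rho>_in RW])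
    moreover have hy: "h u = P y" using h_E' u by (simp add: y_def)
    ultimately have "P y \<in> S \<inter> Q" using uU(2) P_in by (auto simp: S_def Q_def)
    moreover have "u = g (P y)" using g_h(1)[OF uU(1)] hy by simp
    ultimately show "u \<in> g ` (S \<inter> Q)" by blast
  qed
  have oQ: "openin (top_of_set V) Q" and oY: "openin (top_of_set V) (V \<inter> Y)"
    unfolding Q_def using Z Y by (auto intro: openin_open_Int)
  have "embedded_submanifold r m V S"
    unfolding embedded_submanifold_def
  proof (intro conjI ballI)
    show "S \<subseteq> V" by (auto simp: S_def Q_def)
    \<comment> \<open>The single chart \<open>g\<close> on \<open>Q\<close> serves all points of
      \<open>S\<close>.\<close>
    fix q assume "q \<in> S"
    then have "q \<in> Q" by (simp add: S_def)
    then show "\<exists>W W' \<phi> E. openin (top_of_set V) W \<and> q \<in> W \<and> openin (top_of_set V) W' \<and>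
        Cr_diffeomorphism r W W' \<phi> \<and> subspace E \<and> E \<subseteq> V \<and> dim E = m \<and> \<phi> ` (S \<inter> W) = E \<inter> W'"
      using oQ oY slice sE' E'V dE' flat by blast
  qed
  moreover have "openin (top_of_set M) U"
    unfolding U_def using cP Z by (rule continuous_openin_preimage_gen)
  moreover have "x \<in> U" using PxZ x(1) by (simp add: U_def)
  moreover have "P x \<in> Q" using PxZ P_in by (simp add: Q_def)
  ultimately show ?thesis
    using oQ diffeo unfolding S_def P_def by blast
qed

end

subsection \<open>Almost every projection\<close>

text \<open>Separation of \<open>x\<close> from the rest of \<open>X\<close> is a premise because it
  has two sources: a Hausdorff null \<open>X\<close> when \<open>m \<le> k\<close>, and
  \<open>M\<close> itself when \<open>m < k\<close>.\<close>

lemma AE_bi_lipschitz_at: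
  fixes \<gamma> :: "(real^'n) set measure"
  assumes \<gamma>: "invariant_Grassmannian_measure k \<gamma>" "1 \<le> k" "k \<le> CARD('n)"
    and M: "embedded_submanifold r m UNIV M" "1 \<le> r" "m \<le> k"
    and X: "compact X" "X \<subseteq> M" "x \<in> M"
    and inj: "AE V in \<gamma>. \<forall>y\<in>X. y \<noteq> x \<longrightarrow> orth_proj V y \<noteq> orth_proj V x"
  shows "AE V in \<gamma>. \<exists>C\<ge>0. \<forall>y\<in>X. norm (x - y) \<le> C * norm (orth_proj V x - orth_proj V y)"
proof -
  obtain W W' E \<phi> \<psi> A where "submanifold_chart r m M W W' E \<phi> \<psi> A x"
    using submanifold_chart_exists[OF M(1,2) X(3)] by blast
  then interpret submanifold_chart r m M W W' E \<phi> \<psi> A x .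
  have "AE V in \<gamma>. \<forall>t\<in>A ` E. orth_proj V t = 0 \<longrightarrow> t = 0"
    by (rule AE_orth_proj_inj_subspace[OF \<gamma> subspace_tangent]) (simp add: dim_tangent M(3))
  with AE_space inj show ?thesis
  proof eventually_elim
    case (elim V)
    have "subspace V"
      using elim(1) space_Grassmannian_measure[OF \<gamma>(1)] by (auto simp: Grassmannian_def)
    then show ?case
      by (rule bi_lipschitz_at[OF _ _ X(1,2)]) (use elim(2,3) in blast)+
  qed
qed

text \<open>Compactness leaves finitely many patches with box-counting exponent
  \<open>m < k\<close>, each null in the required sense; their exceptional sets of planes are
  united.\<close>

lemma AE_orth_proj_inj_submanifold:
  fixes \<gamma> :: "(real^'n) set measure"
  assumes \<gamma>: "invariant_Grassmannian_measure k \<gamma>" "1 \<le> k" "k \<le> CARD('n)"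
    and M: "embedded_submanifold r m UNIV M" "1 \<le> r" "m < k" "compact M"
  shows "AE V in \<gamma>. \<forall>y\<in>M. y \<noteq> x \<longrightarrow> orth_proj V y \<noteq> orth_proj V x"
proof -
  have "\<exists>N. open N \<and> z \<in> N \<and> box_cover m (M \<inter> N)" if z: "z \<in> M" for z
  proof -
    obtain W W' E \<phi> \<psi> A where "submanifold_chart r m M W W' E \<phi> \<psi> A z"
      using submanifold_chart_exists[OF M(1,2) z] by blast
    then interpret submanifold_chart r m M W W' E \<phi> \<psi> A z .
    show ?thesis using box_cover_local by blast
  qed
  then obtain N where N: "\<And>z. z \<in> M \<Longrightarrow> open (N z)" "\<And>z. z \<in> M \<Longrightarrow> z \<in> N z"
    "\<And>z. z \<in> M \<Longrightarrow> box_cover m (M \<inter> N z)"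
    by metis
  have "M \<subseteq> (\<Union>z\<in>M. N z)" using N(2) by blast
  then obtain D where D: "D \<subseteq> M" "finite D" "M \<subseteq> (\<Union>z\<in>D. N z)"
    using compactE_image[OF M(4), of M N] N(1) by metis
  have "AE V in \<gamma>. \<forall>z\<in>D. \<forall>y\<in>M \<inter> N z. y \<noteq> x \<longrightarrow> orth_proj V y \<noteq> orth_proj V x"
  proof (rule AE_finite_allI[OF D(2)])
    fix z assume "z \<in> D"
    then have "box_cover m (M \<inter> N z)" using N(3) D(1) by blast
    then show "AE V in \<gamma>. \<forall>y\<in>M \<inter> N z. y \<noteq> x \<longrightarrow> orth_proj V y \<noteq> orth_proj V x"
      by (intro AE_orth_proj_inj[OF \<gamma>] null_cover_if_box_cover[OF _ M(3)])
  qed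
  then show ?thesis
    by eventually_elim (use D(3) in blast)
qed

text \<open>The constant and the points of \<open>Y\<close> may be restricted to countable sets, which makes the set of
  good pairs \<open>(V, x)\<close> measurable.\<close>

lemma AE_bi_lipschitz_swap:
  fixes \<gamma> :: "(real^'n) set measure" and \<mu> :: "(real^'n) measure"
  assumes \<gamma>: "invariant_Grassmannian_measure k \<gamma>"
    and \<mu>: "prob_space \<mu>" "sets \<mu> = sets (restrict_space borel X)"
    and ae: "\<And>x. x \<in> X \<Longrightarrow> AE V in \<gamma>. \<exists>C\<ge>0. \<forall>y\<in>Y. norm (x - y) \<le> C * norm (orth_proj V x - orth_proj V y)"
  shows "AE V in \<gamma>. AE x in \<mu>. \<exists>C\<ge>0. \<forall>y\<in>Y. norm (x - y) \<le> C * norm (orth_proj V x - orth_proj V y)"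
proof -
  have ps: "prob_space \<gamma>" using \<gamma> unfolding invariant_Grassmannian_measure_def by blast
  interpret \<gamma>: prob_space \<gamma> by (rule ps)
  interpret \<mu>: prob_space \<mu> by (rule \<mu>(1))
  interpret P: pair_sigma_finite \<gamma> \<mu> ..
  have sp\<mu>: "space \<mu> = X"
    using sets_eq_imp_space_eq[OF \<mu>(2)] by (simp add: space_restrict_space)
  obtain D where D: "countable D" "D \<subseteq> Y" "Y \<subseteq> closure D"
    using separable[of Y] by metis
  define G where "G V x \<longleftrightarrow> (\<exists>n::nat. \<forall>y\<in>D. norm (x - y) \<le> real n * norm (orth_proj V x - orth_proj V y))"
    for V :: "(real^'n) set" and x
  have G: "G V x \<longleftrightarrow> (\<exists>C\<ge>0. \<forall>y\<in>Y. norm (x - y) \<le> C * norm (orth_proj V x - orth_proj V y))"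
    if V: "V \<in> space \<gamma>" for V x
  proof
    have "subspace V"
      using V space_Grassmannian_measure[OF \<gamma>] by (auto simp: Grassmannian_def)
    then have cP: "continuous_on S (orth_proj V)" for S
      using linear_orth_proj linear_continuous_on linear_conv_bounded_linear by blast
    assume "G V x"
    then obtain n :: nat where n: "\<And>y. y \<in> D \<Longrightarrow> norm (x - y) \<le> real n * norm (orth_proj V x - orth_proj V y)"
      unfolding G_def by blast
    \<comment> \<open>For a fixed constant the inequality is closed in \<open>y\<close>, so it
      passes from \<open>D\<close> to its closure.\<close>
    have "closed {y. norm (x - y) \<le> real n * norm (orth_proj V x - orth_proj V y)}"
      by (intro closed_Collect_le continuous_intros cP)
    then have "closure D \<subseteq> {y. norm (x - y) \<le> real n * norm (orth_proj V x - orth_proj V y)}"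
      using n by (intro closure_minimal) auto
    then show "\<exists>C\<ge>0. \<forall>y\<in>Y. norm (x - y) \<le> C * norm (orth_proj V x - orth_proj V y)"
      using D(3) by (intro exI[of _ "real n"]) auto
  next
    assume "\<exists>C\<ge>0. \<forall>y\<in>Y. norm (x - y) \<le> C * norm (orth_proj V x - orth_proj V y)"
    then obtain C where C: "\<And>y. y \<in> Y \<Longrightarrow> norm (x - y) \<le> C * norm (orth_proj V x - orth_proj V y)" by blast
    obtain n :: nat where n: "C \<le> real n" using real_arch_simple by blast
    have "norm (x - y) \<le> real n * norm (orth_proj V x - orth_proj V y)" if "y \<in> D" for y
      using C[of y] that D(2) mult_right_mono[OF n, of "norm (orth_proj V x - orth_proj V y)"] by fastforce
    then show "G V x" unfolding G_def by blast
  qed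
  have "(\<lambda>x. x) \<in> borel_measurable (restrict_space borel X)"
    by (rule measurable_restrict_space1) simp
  then have id_\<mu>: "(\<lambda>x. x) \<in> borel_measurable \<mu>"
    unfolding measurable_cong_sets[OF \<mu>(2) refl] .
  have [measurable]: "(\<lambda>p. orth_proj (fst p) (snd p)) \<in> borel_measurable (\<gamma> \<Otimes>\<^sub>M \<mu>)"
    using orth_proj_measurable[OF \<gamma> id_\<mu>] by (simp add: case_prod_beta)
  have [measurable]: "(\<lambda>p. snd p) \<in> borel_measurable (\<gamma> \<Otimes>\<^sub>M \<mu>)"
    using measurable_compose[OF measurable_snd id_\<mu>, of \<gamma>] by simp
  have [measurable]: "(\<lambda>p. orth_proj (fst p) y) \<in> borel_measurable (\<gamma> \<Otimes>\<^sub>M \<mu>)" for y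
    using measurable_compose[OF measurable_fst orth_proj_measurable_left[OF \<gamma>, of y], of \<mu>] by simp
  have meas: "{p\<in>space (\<gamma> \<Otimes>\<^sub>M \<mu>). G (fst p) (snd p)} \<in> sets (\<gamma> \<Otimes>\<^sub>M \<mu>)"
    unfolding G_def
    by (intro sets.sets_Collect_countable_Ex sets.sets_Collect_countable_All'[OF _ D(1)]) measurable
  have "AE V in \<gamma>. G V x" if "x \<in> X" for x
    using AE_space ae[OF that] by eventually_elim (simp add: G)
  then have "AE x in \<mu>. AE V in \<gamma>. G V x"
    by (rule AE_I2) (simp add: sp\<mu>)
  then have "AE V in \<gamma>. AE x in \<mu>. G V x"
    using P.AE_commute[OF meas] by blast
  with AE_space show ?thesis
    by eventually_elim (simp add: G)
qed

theorem theorem3p2: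
  fixes r :: enat
    and k m :: nat
    and M X :: "(real ^ 'n) set"
    and \<mu> :: "(real ^ 'n) measure"
    and \<gamma> :: "(real ^ 'n) set measure"
  assumes "1 \<le> r"
    and "compact M" and "embedded_submanifold r m UNIV M"
    and "compact X" and "X \<subseteq> M"
    and "prob_space \<mu>" and "sets \<mu> = sets (restrict_space borel X)"
    and "1 \<le> k" and "k \<le> CARD('n)"
    and "invariant_Grassmannian_measure k \<gamma>"
  shows "AE V in \<gamma>.
    (hausdorff_measure k X = 0 \<and> m \<le> k \<longrightarrow>
       (AE x in \<mu>. \<exists>C\<ge>0. \<forall>y\<in>X. norm (x - y) \<le> C * norm (orth_proj V x - orth_proj V y))) \<and>
    (m < k \<longrightarrow>
       (AE x in \<mu>. \<exists>U Q.
          openin (top_of_set M) U \<and> x \<in> U \<and>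
          openin (top_of_set V) Q \<and> orth_proj V x \<in> Q \<and>
          embedded_submanifold r m V (Q \<inter> orth_proj V ` M) \<and>
          Cr_diffeomorphism r U (Q \<inter> orth_proj V ` M) (orth_proj V)))"
proof -
  note \<gamma> = assms(10,8,9)
  have sp\<mu>: "space \<mu> = X"
    using sets_eq_imp_space_eq[OF assms(7)] by (simp add: space_restrict_space)
  have 1: "AE V in \<gamma>. AE x in \<mu>. \<exists>C\<ge>0. \<forall>y\<in>X. norm (x - y) \<le> C * norm (orth_proj V x - orth_proj V y)"
    if "hausdorff_measure k X = 0" "m \<le> k"
  proof (rule AE_bi_lipschitz_swap[OF \<gamma>(1) assms(6,7)])
    fix x assume "x \<in> X"
    then have "x \<in> M" using assms(5) by blast
    then show "AE V in \<gamma>. \<exists>C\<ge>0. \<forall>y\<in>X. norm (x - y) \<le> C * norm (orth_proj V x - orth_proj V y)"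
      by (intro AE_bi_lipschitz_at[OF \<gamma> assms(3,1) that(2) assms(4,5)]
          AE_orth_proj_inj[OF \<gamma>] null_cover_if_hausdorff_null that(1) assms(8))
  qed
  \<comment> \<open>The bound is taken over all of \<open>M\<close>, since points of
    \<open>M\<close> outside \<open>X\<close> must also be kept away from the fibre of
    \<open>x\<close>.\<close>
  have 2: "AE V in \<gamma>. AE x in \<mu>. \<exists>C\<ge>0. \<forall>y\<in>M. norm (x - y) \<le> C * norm (orth_proj V x - orth_proj V y)"
    if "m < k"
  proof (rule AE_bi_lipschitz_swap[OF \<gamma>(1) assms(6,7)])
    fix x assume "x \<in> X"
    then have "x \<in> M" using assms(5) by blast
    then show "AE V in \<gamma>. \<exists>C\<ge>0. \<forall>y\<in>M. norm (x - y) \<le> C * norm (orth_proj V x - orth_proj V y)"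
      by (intro AE_bi_lipschitz_at[OF \<gamma> assms(3,1) less_imp_le[OF that] assms(2) subset_refl]
          AE_orth_proj_inj_submanifold[OF \<gamma> assms(3,1) that assms(2)])
  qed
  \<comment> \<open>The premises do not depend on \<open>V\<close>, so a case distinction moves them
    under the quantifier.\<close>
  have "AE V in \<gamma>. hausdorff_measure k X = 0 \<and> m \<le> k \<longrightarrow>
       (AE x in \<mu>. \<exists>C\<ge>0. \<forall>y\<in>X. norm (x - y) \<le> C * norm (orth_proj V x - orth_proj V y))"
    using 1 by (cases "hausdorff_measure k X = 0 \<and> m \<le> k") auto
  moreover have "AE V in \<gamma>. m < k \<longrightarrow>
       (AE x in \<mu>. \<exists>C\<ge>0. \<forall>y\<in>M. norm (x - y) \<le> C * norm (orth_proj V x - orth_proj V y))"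
    using 2 by (cases "m < k") auto
  ultimately show ?thesis
    using AE_space
  proof eventually_elim
    case (elim V)
    have V: "subspace V"
      using elim(3) space_Grassmannian_measure[OF \<gamma>(1)] by (auto simp: Grassmannian_def)
    show ?case
    proof (intro conjI impI)
      assume "hausdorff_measure k X = 0 \<and> m \<le> k"
      with elim(1) show "AE x in \<mu>. \<exists>C\<ge>0. \<forall>y\<in>X. norm (x - y) \<le> C * norm (orth_proj V x - orth_proj V y)"
        by blast
    next
      assume "m < k"
      with elim(2) have "AE x in \<mu>. \<exists>C\<ge>0. \<forall>y\<in>M. norm (x - y) \<le> C * norm (orth_proj V x - orth_proj V y)"
        by blast
      with AE_space show "AE x in \<mu>. \<exists>U Q.
          openin (top_of_set M) U \<and> x \<in> U \<and>
          openin (top_of_set V) Q \<and> orth_proj V x \<in> Q \<and>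
          embedded_submanifold r m V (Q \<inter> orth_proj V ` M) \<and>
          Cr_diffeomorphism r U (Q \<inter> orth_proj V ` M) (orth_proj V)"
      proof eventually_elim
        case (elim x)
        then have "x \<in> M" using sp\<mu> assms(5) by blast
        then obtain W W' E \<phi> \<psi> A where "submanifold_chart r m M W W' E \<phi> \<psi> A x"
          using submanifold_chart_exists[OF assms(3,1)] by blast
        then interpret submanifold_chart r m M W W' E \<phi> \<psi> A x .
        \<comment> \<open>From here the argument is deterministic: the bound at this pair already
          yields the charts.\<close>
        show ?case
          using elim(2) projection_chart[OF V assms(2)] by blast
      qed
    qed
  qed
qed

end
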